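(* Let $T>0$, $H\in(1/2,1)$, $d\ge 1$, $K\ge 1$, $c=(c_1,\dots,c_d)\in\mathbb R^d$, and let $b:[0,T]\times\mathbb R^d\to\mathbb R^d$ and $\sigma=(\sigma_1,\dots,\sigma_d):[0,T]\to\mathbb R^d$ be such that $b,\partial_{x_1}b,\dots,\partial_{x_d}b$ are bounded and continuous on $[0,T]\times\mathbb R^d$, and $\sigma_1,\dots,\sigma_d$ are bounded and continuous on $[0,T]$. Then the Cauchy problem $$\frac{dX_i^K(t)}{dt}=b_i(t,X^K(t))+\sigma_i(t)X_i^K(t)\diamond\frac{dB_i^K(t)}{dt},\quad t\in\,]0,T],\qquad X_i^K(0)=c_i,\qquad i\in\{1,\dots,d\},$$ has a mild solution, in the sense defined in the context.
   Context: **Probability space.** $\Omega=C_0([0,T],\mathbb R^d)$ is the space of $\mathbb R^d$-valued continuous functions on $[0,T]$ (vanishing at $0$) with the uniform topology, and $P^H$ is the probability measure on its Borel sets under which the coordinate process $B(t,\omega)=\omega(t)$ is a $d$-dimensional fractional Brownian motion of Hurst parameter $H\in(1/2,1)$: its components $B_1,\dots,B_d$ are independent centered Gaussian processes with $\mathbb E[B_i(t)B_i(s)]=\frac12(t^{2H}+s^{2H}-|t-s|^{2H})$. **The space $\mathcal H_\phi$.** Let $\phi(s,t)=H(2H-1)|s-t|^{2H-2}$ and $\langle f,g\rangle_\phi=\int_0^T\int_0^T f(s)g(t)\phi(s,t)\,ds\,dt$, $|f|_\phi^2=\langle f,f\rangle_\phi$. $\mathcal H_\phi$ is the separable Hilbert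 space obtained as the closure (completion) of $L^2([0,T])$ with respect to $\langle\cdot,\cdot\rangle_\phi$. For $f\in\mathcal H_\phi$ set $\Phi[f](t)=\int_0^T f(s)\phi(t,s)\,ds$, so that $\int_0^t\Phi[f](r)\,dr=\langle f,\chi_{[0,t]}\rangle_\phi$. The fractional Wiener integral $\int_0^T f(s)\,dB_i(s)$ is the centered Gaussian random variable determined by linearity, by $\int_0^T\chi_{[0,t]}dB_i=B_i(t)$ and by the isometry $\mathbb E[(\int_0^T f\,dB_i)^2]=|f|_\phi^2$. **Approximating noise.** $\{e_k\}_{k\ge1}$ is a fixed complete orthonormal system of $\mathcal H_\phi$, $\xi_k=\Phi[e_k]$ (continuous functions on $[0,T]$), $Z_k^{(i)}=\int_0^T e_k(s)\,dB_i(s)$, and $\frac{dB_i^K(t)}{dt}=\sum_{k=1}^K\xi_k(t)Z_k^{(i)}$, the time derivative of the truncated Cameron–Martin expansion of $B_i$. **Stochastic exponentials and Wick product.** For $f\in\mathcal H_\phi$ and $i\in\{1,\dots,d\}$, $\mathcal E_i(f)=\exp\{\int_0^T f(s)\,dB_i(s)-\frac12|f|_\phi^2\}$. For $X\in\mathbb L^p(\Omega)$ with some $p>1$, the Wick product with $\mathcal E_i(f)$ is $X\diamond\mathcal E_i(f)=\mathtt T_{-\Phi[f]_i}X\cdot\mathcal E_i(f)$, where $(\mathtt T_{-\Phi[f]_i}X)(\omega)=X\big(\omega-\epsilon_i\int_0^{\cdot}\Phi[f](r)\,dr\big)$ and $\{\epsilon_1,\dots,\epsilon_d\}$ is the canonical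 basis of $\mathbb R^d$. For $0\le r\le t\le T$, $\sigma_i^K(r,t;\cdot)$ denotes the orthogonal projection in $\mathcal H_\phi$ of $\chi_{[r,t]}\sigma_i$ onto $\operatorname{span}\{e_1,\dots,e_K\}$, and $\mathcal E_i^K(r,t)=\mathcal E_i(\sigma_i^K(r,t;\cdot))$. **Mild solution.** A $d$-dimensional process $\{X^K(t)\}_{t\in[0,T]}$ is a mild solution of the Cauchy problem if: (1) $t\mapsto X^K(t)$ is almost surely continuous; (2) for all $i$ and $t\in[0,T]$, $X_i^K(t)\in\mathbb L^p(\Omega)$ for some $p>1$; (3) for all $i\in\{1,\dots,d\}$, almost surely $$X_i^K(t)=c_i\,\mathcal E_i^K(0,t)+\int_0^t b_i(s,X^K(s))\diamond\mathcal E_i^K(s,t)\,ds,\qquad t\in[0,T].$$ *)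

theory Defs
  imports "HOL-Probability.Probability"
begin

section \<open>Path space and fractional Brownian motion\<close>

text \<open>The space of continuous functions on \<open>[0,T]\<close> vanishing at \<open>0\<close>, with the uniform topology.
  A path is identified with its extension to the real line by its boundary values; this is an
  isometry for the supremum norms, so the topology is the one of the type \<open>bcontfun\<close>.\<close>

type_synonym 'd path = "real \<Rightarrow>\<^sub>C (real ^ 'd)"

definition path_of :: "real \<Rightarrow> (real \<Rightarrow> real ^ 'd) \<Rightarrow> 'd::finite path" where
  "path_of T f = Bcontfun (\<lambda>t. f (max 0 (min T t)))"

definition path_space :: "real \<Rightarrow> 'd::finite path set" where
  "path_space T = {\<omega>. apply_bcontfun \<omega> 0 = 0 \<and>
     (\<forall>t. apply_bcontfun \<omega> t = apply_bcontfun \<omega> (max 0 (min T t)))}"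

text \<open>Degenerate Gaussian variables (variance zero) are allowed.\<close>

definition centered_gaussian :: "'a measure \<Rightarrow> ('a \<Rightarrow> real) \<Rightarrow> bool" where
  "centered_gaussian M X \<longleftrightarrow> X \<in> borel_measurable M \<and>
     ((\<exists>s>0. distributed M lborel X (\<lambda>x. ennreal (normal_density 0 s x))) \<or>
      (AE \<omega> in M. X \<omega> = 0))"

definition centered_gaussian_process ::
    "'a measure \<Rightarrow> real set \<Rightarrow> (real \<Rightarrow> 'a \<Rightarrow> real) \<Rightarrow> bool" where
  "centered_gaussian_process M I X \<longleftrightarrow>
     (\<forall>J a. finite J \<longrightarrow> J \<subseteq> I \<longrightarrow> centered_gaussian M (\<lambda>\<omega>. \<Sum>t\<in>J. a t * X t \<omega>))"

definition fbm_measure :: "real \<Rightarrow> real \<Rightarrow> 'd::finite path measure \<Rightarrow> bool" where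
  "fbm_measure H T P \<longleftrightarrow>
     prob_space P \<and>
     space P = path_space T \<and> sets P = sets (restrict_space borel (path_space T)) \<and>
     prob_space.indep_vars P (\<lambda>_. Pi\<^sub>M {0..T} (\<lambda>_. borel))
       (\<lambda>i \<omega>. \<lambda>t\<in>{0..T}. apply_bcontfun \<omega> t $ i) (UNIV :: 'd set) \<and>
     (\<forall>i. centered_gaussian_process P {0..T} (\<lambda>t \<omega>. apply_bcontfun \<omega> t $ i)) \<and>
     (\<forall>i. \<forall>t\<in>{0..T}. \<forall>s\<in>{0..T}.
        (\<integral>\<omega>. (apply_bcontfun \<omega> t $ i) * (apply_bcontfun \<omega> s $ i) \<partial>P) =
          (t powr (2 * H) + s powr (2 * H) - \<bar>t - s\<bar> powr (2 * H)) / 2)"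


section \<open>The Hilbert space of integrands\<close>

definition phi_kernel :: "real \<Rightarrow> real \<Rightarrow> real \<Rightarrow> real" where
  "phi_kernel H s t = H * (2 * H - 1) * \<bar>s - t\<bar> powr (2 * H - 2)"

definition L2_fun :: "real \<Rightarrow> (real \<Rightarrow> real) set" where
  "L2_fun T = {f. set_borel_measurable lborel {0..T} f \<and>
                  set_integrable lborel {0..T} (\<lambda>s. (f s)\<^sup>2)}"

definition phi_inner :: "real \<Rightarrow> real \<Rightarrow> (real \<Rightarrow> real) \<Rightarrow> (real \<Rightarrow> real) \<Rightarrow> real" where
  "phi_inner H T f g =
     (LINT s:{0..T}|lborel. (LINT t:{0..T}|lborel. f s * g t * phi_kernel H s t))"

text \<open>The target of \<open>\<iota>\<close> is the completion of \<open>L\<^sup>2([0,T])\<close> for \<open>phi_inner\<close>: a Hilbert space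
  containing an isometric dense linear image of \<open>L\<^sup>2([0,T])\<close>. This determines it up to a unique
  isometric isomorphism compatible with \<open>\<iota>\<close>. Functions with the same class in \<open>L\<^sup>2([0,T])\<close>
  necessarily have the same image.\<close>

definition phi_completion ::
    "real \<Rightarrow> real \<Rightarrow> ((real \<Rightarrow> real) \<Rightarrow> 'h::{real_inner,complete_space}) \<Rightarrow> bool" where
  "phi_completion H T \<iota> \<longleftrightarrow>
     (\<forall>f\<in>L2_fun T. \<forall>g\<in>L2_fun T. \<forall>a b.
        \<iota> (\<lambda>s. a * f s + b * g s) = a *\<^sub>R \<iota> f + b *\<^sub>R \<iota> g) \<and>
     (\<forall>f\<in>L2_fun T. \<forall>g\<in>L2_fun T. inner (\<iota> f) (\<iota> g) = phi_inner H T f g) \<and>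
     closure (\<iota> ` L2_fun T) = UNIV"

definition complete_orthonormal :: "(nat \<Rightarrow> 'h::real_inner) \<Rightarrow> bool" where
  "complete_orthonormal e \<longleftrightarrow>
     (\<forall>j\<ge>1. \<forall>k\<ge>1. inner (e j) (e k) = (if j = k then 1 else 0)) \<and>
     closure (span (e ` {1..})) = UNIV"

definition orth_proj :: "'h::real_inner set \<Rightarrow> 'h \<Rightarrow> 'h" where
  "orth_proj S x = (THE y. y \<in> S \<and> (\<forall>z\<in>S. inner (x - y) z = 0))"

definition phi_integral :: "real \<Rightarrow> real \<Rightarrow> (real \<Rightarrow> real) \<Rightarrow> real \<Rightarrow> real" where
  "phi_integral H T f t = (LINT s:{0..T}|lborel. f s * phi_kernel H t s)"

text \<open>\<open>g\<close> is a version of \<open>\<Phi>[f]\<close>. Elements of the completion need not be functions, so the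
  kernel operator \<open>phi_integral\<close> is extended from \<open>L\<^sup>2([0,T])\<close> by continuity, as a map into
  \<open>L\<^sup>1([0,T])\<close>; in particular \<open>\<Phi>[f]\<close> is determined up to null sets.\<close>

definition is_Phi :: "real \<Rightarrow> real \<Rightarrow> ((real \<Rightarrow> real) \<Rightarrow> 'h::real_inner) \<Rightarrow> 'h \<Rightarrow> (real \<Rightarrow> real) \<Rightarrow> bool" where
  "is_Phi H T \<iota> f g \<longleftrightarrow> set_integrable lborel {0..T} g \<and>
     (\<exists>u. (\<forall>n. u n \<in> L2_fun T) \<and> (\<lambda>n. \<iota> (u n)) \<longlonglongrightarrow> f \<and>
          (\<lambda>n. LINT t:{0..T}|lborel. \<bar>phi_integral H T (u n) t - g t\<bar>) \<longlonglongrightarrow> 0)"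

definition Phi :: "real \<Rightarrow> real \<Rightarrow> ((real \<Rightarrow> real) \<Rightarrow> 'h::real_inner) \<Rightarrow> 'h \<Rightarrow> real \<Rightarrow> real" where
  "Phi H T \<iota> f = (SOME g. is_Phi H T \<iota> f g)"


section \<open>Wiener integrals, stochastic exponentials and Wick products\<close>

text \<open>\<open>W i f\<close> is the integral of \<open>f\<close> against the \<open>i\<close>-th component. Each \<open>W i f\<close> is only determined
  almost surely; since below uncountably many integrands occur at once, the versions are required
  to depend linearly on \<open>f\<close> for every path, so that the integral of a linear combination of
  \<open>e 1, \<dots>, e K\<close> is the same linear combination of the variables \<open>W i (e k)\<close>. Such versions exist:
  choose them arbitrarily on a Hamel basis and extend linearly.\<close>

definition wiener_integral ::
    "real \<Rightarrow> 'd::finite path measure \<Rightarrow> ((real \<Rightarrow> real) \<Rightarrow> 'h::real_inner) \<Rightarrow>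
     ('d \<Rightarrow> 'h \<Rightarrow> 'd path \<Rightarrow> real) \<Rightarrow> bool" where
  "wiener_integral T P \<iota> W \<longleftrightarrow> (\<forall>i.
     (\<forall>\<omega>\<in>space P. linear (\<lambda>f. W i f \<omega>)) \<and>
     (\<forall>f. centered_gaussian P (W i f)) \<and>
     (\<forall>t\<in>{0..T}. AE \<omega> in P. W i (\<iota> (indicator {0..t})) \<omega> = apply_bcontfun \<omega> t $ i) \<and>
     (\<forall>f. (\<integral>\<omega>. (W i f \<omega>)\<^sup>2 \<partial>P) = (norm f)\<^sup>2))"

definition stoch_exp ::
    "('d \<Rightarrow> 'h::real_inner \<Rightarrow> 'd path \<Rightarrow> real) \<Rightarrow> 'd::finite \<Rightarrow> 'h \<Rightarrow> 'd path \<Rightarrow> real" where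
  "stoch_exp W i f \<omega> = exp (W i f \<omega> - (norm f)\<^sup>2 / 2)"

definition translate ::
    "real \<Rightarrow> real \<Rightarrow> ((real \<Rightarrow> real) \<Rightarrow> 'h::real_inner) \<Rightarrow> 'd::finite \<Rightarrow> 'h \<Rightarrow>
     ('d path \<Rightarrow> real) \<Rightarrow> 'd path \<Rightarrow> real" where
  "translate H T \<iota> i f X \<omega> =
     X (\<omega> - path_of T (\<lambda>t. (LINT r:{0..t}|lborel. Phi H T \<iota> f r) *\<^sub>R axis i 1))"

definition wick ::
    "real \<Rightarrow> real \<Rightarrow> ((real \<Rightarrow> real) \<Rightarrow> 'h::real_inner) \<Rightarrow> ('d \<Rightarrow> 'h \<Rightarrow> 'd path \<Rightarrow> real) \<Rightarrow>
     'd::finite \<Rightarrow> ('d path \<Rightarrow> real) \<Rightarrow> 'h \<Rightarrow> 'd path \<Rightarrow> real" where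
  "wick H T \<iota> W i X f \<omega> = translate H T \<iota> i f X \<omega> * stoch_exp W i f \<omega>"


section \<open>Mild solutions\<close>

definition sigma_proj ::
    "((real \<Rightarrow> real) \<Rightarrow> 'h::real_inner) \<Rightarrow> (nat \<Rightarrow> 'h) \<Rightarrow> nat \<Rightarrow> (real \<Rightarrow> real ^ 'd) \<Rightarrow> 'd::finite \<Rightarrow>
     real \<Rightarrow> real \<Rightarrow> 'h" where
  "sigma_proj \<iota> e K \<sigma> i r t =
     orth_proj (span (e ` {1..K})) (\<iota> (\<lambda>s. indicator {r..t} s * \<sigma> s $ i))"

definition mild_solution ::
    "real \<Rightarrow> real \<Rightarrow> 'd::finite path measure \<Rightarrow> ((real \<Rightarrow> real) \<Rightarrow> 'h::real_inner) \<Rightarrow>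
     ('d \<Rightarrow> 'h \<Rightarrow> 'd path \<Rightarrow> real) \<Rightarrow> (nat \<Rightarrow> 'h) \<Rightarrow> nat \<Rightarrow>
     (real \<Rightarrow> real ^ 'd \<Rightarrow> real ^ 'd) \<Rightarrow> (real \<Rightarrow> real ^ 'd) \<Rightarrow> real ^ 'd \<Rightarrow>
     (real \<Rightarrow> 'd path \<Rightarrow> real ^ 'd) \<Rightarrow> bool" where
  "mild_solution H T P \<iota> W e K b \<sigma> c X \<longleftrightarrow>
     (\<forall>t\<in>{0..T}. X t \<in> borel_measurable P) \<and>
     (AE \<omega> in P. continuous_on {0..T} (\<lambda>t. X t \<omega>)) \<and>
     (\<forall>i. \<forall>t\<in>{0..T}. \<exists>p>1. integrable P (\<lambda>\<omega>. \<bar>X t \<omega> $ i\<bar> powr p)) \<and>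
     (\<forall>i. AE \<omega> in P. \<forall>t\<in>{0..T}.
        set_integrable lborel {0..t}
          (\<lambda>s. wick H T \<iota> W i (\<lambda>\<omega>'. b s (X s \<omega>') $ i) (sigma_proj \<iota> e K \<sigma> i s t) \<omega>) \<and>
        X t \<omega> $ i =
          c $ i * stoch_exp W i (sigma_proj \<iota> e K \<sigma> i 0 t) \<omega> +
          (LINT s:{0..t}|lborel.
             wick H T \<iota> W i (\<lambda>\<omega>'. b s (X s \<omega>') $ i) (sigma_proj \<iota> e K \<sigma> i s t) \<omega>))"

definition partial_deriv :: "'d::finite \<Rightarrow> (real ^ 'd \<Rightarrow> real ^ 'd) \<Rightarrow> real ^ 'd \<Rightarrow> real ^ 'd" where
  "partial_deriv j f x = vector_derivative (\<lambda>h. f (x + h *\<^sub>R axis j 1)) (at 0)"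

end

theory Submission
  imports Defs
begin

text \<open>For fixed truncation \<open>K\<close> everything happens in the span of \<open>e 1, \<dots>, e K\<close>. Replace the
  random vector of the integrals of the basis by a deterministic variable \<open>z\<close>. The projection of
  \<open>\<sigma>\<close> cut off to \<open>[s, t]\<close> is \<open>\<Gamma> t - \<Gamma> s\<close> for a Lipschitz curve \<open>\<Gamma>\<close>, and translation by
  \<open>\<Phi>[f]\<close> acts as \<open>z \<mapsto> z - f\<close>, so the mild equation becomes an integral equation for a deterministic
  function \<open>F(t, z)\<close>. It is a contraction for the weight \<open>exp (\<kappa> t + M t \<bar>z\<bar>)\<close>: the growth
  \<open>exp (M (t - s) \<bar>z\<bar>)\<close> of the stochastic exponential from \<open>s\<close> to \<open>t\<close> is compensated exactly by
  the term \<open>M t \<bar>z\<bar>\<close>. The solution is \<open>X t = F(t, Z)\<close>, where \<open>Z\<close> is a version of the integrals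
  for which the translation rule holds for all shifts outside one null set; it is the limit of
  integrals of step functions, which are dense.\<close>

section \<open>A contraction with a weighted norm\<close>

text \<open>The obstacle is the Wick product: it evaluates the unknown \<open>X s\<close> at a
  shifted path, and the shift runs with s and t through uncountably many directions, whereas
  \<open>W\<close> is tied to the path only up to null sets. An iteration on random variables would
  have to control all these exceptional sets. In the deterministic equation there are none: z ranges
  over \<open>'h ^ 'd\<close>, its entry i stands for the vector that represents f ->
  \<open>W i f\<close> on the span, and a shift in direction i moves only this entry. Randomness
  enters once, at the end, by substitution. A shift also enlarges the norm of z. If M is the
  Lipschitz constant of the curve, the enlargement is at most M T, so the weight at the shifted
  point exceeds the one at z by at most the factor exp (M T * M T); \<kappa> is chosen large enough
  to beat this constant. The Lipschitz bound is where the truncation enters: the curve has finitely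
  many coefficients, each the primitive of a continuous function, namely a component of \<sigma>
  times some \<xi> k.\<close>

lemma partial_derivs_imp_lipschitz:
  fixes f :: "real ^ 'd::finite \<Rightarrow> real ^ 'd"
  assumes diff: "\<And>j x. (\<lambda>h. f (x + h *\<^sub>R axis j 1)) differentiable (at 0)"
    and bd: "\<And>j x. norm (partial_deriv j f x) \<le> L"
  shows "norm (f x - f y) \<le> real CARD('d) * L * norm (x - y)"
proof -
  have L0: "0 \<le> L" using bd[of undefined undefined] norm_ge_zero order_trans by blast
  have line: "norm (f (x + a *\<^sub>R axis j 1) - f x) \<le> L * \<bar>a\<bar>" for x a j
  proof -
    \<comment> \<open>\<open>partial_deriv\<close> is a derivative at 0. At a general
      \<open>h\<close> it is taken at the base point moved by \<open>h\<close> along the axis, and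
      composition with r - h brings it back to the fixed line.\<close>
    have d: "((\<lambda>h. f (x + h *\<^sub>R axis j 1)) has_vector_derivative partial_deriv j f (x + h *\<^sub>R axis j 1))
        (at h within UNIV)" for h
    proof -
      have "((\<lambda>k. f ((x + h *\<^sub>R axis j 1) + k *\<^sub>R axis j 1)) has_vector_derivative
          partial_deriv j f (x + h *\<^sub>R axis j 1)) (at 0)"
        unfolding partial_deriv_def
        using diff vector_derivative_works by blast
      then have "((\<lambda>k. f (x + (h + k) *\<^sub>R axis j 1)) has_vector_derivative
          partial_deriv j f (x + h *\<^sub>R axis j 1)) (at (h - h))"
        by (simp add: algebra_simps)
      then have "(((\<lambda>k. f (x + (h + k) *\<^sub>R axis j 1)) \<circ> (\<lambda>r. r - h)) has_vector_derivative
          1 *\<^sub>R partial_deriv j f (x + h *\<^sub>R axis j 1)) (at h)"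
        by (intro vector_diff_chain_at) (auto intro!: derivative_eq_intros)
      then show ?thesis by (simp add: o_def)
    qed
    have "norm (f (x + a *\<^sub>R axis j 1) - f (x + 0 *\<^sub>R axis j 1)) \<le> L * norm (a - 0)"
    proof (rule differentiable_bound[OF convex_UNIV d[unfolded has_vector_derivative_def]])
      show "onorm (\<lambda>r. r *\<^sub>R partial_deriv j f (x + h *\<^sub>R axis j 1)) \<le> L" for h
        by (rule onorm_le) (simp add: mult.commute[of L] mult_left_mono bd)
    qed auto
    then show ?thesis by simp
  qed
  \<comment> \<open>The way from \<open>y\<close> to \<open>x\<close> is cut into moves along single
    axes, \<open>S\<close> being the axes already used. This gives \<open>L\<close> times the sum of
    the coordinate distances, whence the factor \<open>CARD('d)\<close>.\<close>
  have sum: "norm (f (y + (\<Sum>j\<in>S. (x - y) $ j *\<^sub>R axis j 1)) - f y) \<le> (\<Sum>j\<in>S. L * \<bar>(x - y) $ j\<bar>)"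
    if "finite S" for S using that
  proof (induction S)
    case (insert j S)
    let ?p = "y + (\<Sum>j\<in>S. (x - y) $ j *\<^sub>R axis j 1)"
    have "norm (f (?p + (x - y) $ j *\<^sub>R axis j 1) - f y) \<le>
        norm (f (?p + (x - y) $ j *\<^sub>R axis j 1) - f ?p) + norm (f ?p - f y)"
      using norm_triangle_ineq[of "f (?p + (x - y) $ j *\<^sub>R axis j 1) - f ?p" "f ?p - f y"] by simp
    with insert line[of ?p "(x-y)$j" j] show ?case
      by (simp add: algebra_simps)
  qed simp
  have "(\<Sum>j\<in>UNIV. (x - y) $ j *\<^sub>R axis j 1) = x - y"
    using basis_expansion[of "x - y"] by (simp add: scalar_mult_eq_scaleR)
  then have "norm (f x - f y) \<le> (\<Sum>j\<in>UNIV. L * \<bar>(x - y) $ j\<bar>)"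
    using sum[of UNIV] by simp
  also have "\<dots> \<le> (\<Sum>j\<in>(UNIV::'d set). L * norm (x - y))"
    by (intro sum_mono mult_left_mono component_le_norm_cart L0)
  finally show ?thesis by simp
qed

text \<open>Division by \<open>w\<close> identifies the continuous functions of growth
  \<open>w\<close> with the bounded continuous ones, which form a complete space, and conjugates
  \<Psi> to a q-contraction \<Phi>. Banach's theorem applies there.\<close>

lemma weighted_contraction_fixpoint:
  fixes \<Psi> :: "('x::metric_space \<Rightarrow> 'y::banach) \<Rightarrow> 'x \<Rightarrow> 'y" and w :: "'x \<Rightarrow> real"
  assumes w: "continuous_on UNIV w" "\<And>x. w x > 0"
    and cont: "\<And>F. continuous_on UNIV F \<Longrightarrow> continuous_on UNIV (\<Psi> F)"
    and bdd: "\<And>F. continuous_on UNIV F \<Longrightarrow> \<exists>C. \<forall>x. norm (\<Psi> F x) \<le> C * w x"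
    and contr: "\<And>F F' D x. continuous_on UNIV F \<Longrightarrow> continuous_on UNIV F' \<Longrightarrow>
       (\<And>y. norm (F y - F' y) \<le> D * w y) \<Longrightarrow> norm (\<Psi> F x - \<Psi> F' x) \<le> q * D * w x"
    and q: "0 \<le> q" "q < 1"
  shows "\<exists>F. continuous_on UNIV F \<and> (\<exists>C. \<forall>x. norm (F x) \<le> C * w x) \<and> \<Psi> F = F"
proof -
  define E where "E G x = w x *\<^sub>R apply_bcontfun G x" for G :: "'x \<Rightarrow>\<^sub>C 'y" and x
  define \<Phi> where "\<Phi> G = Bcontfun (\<lambda>x. (1 / w x) *\<^sub>R \<Psi> (E G) x)" for G
  have w0: "w x \<noteq> 0" for x using w(2)[of x] by simp
  have contE: "continuous_on UNIV (E G)" for G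
    unfolding E_def[abs_def] by (intro continuous_intros w) auto
  have appl: "apply_bcontfun (\<Phi> G) x = (1 / w x) *\<^sub>R \<Psi> (E G) x" for G x
  proof -
    obtain C where C: "\<And>x. norm (\<Psi> (E G) x) \<le> C * w x" using bdd[OF contE] by blast
    have "(\<lambda>x. (1 / w x) *\<^sub>R \<Psi> (E G) x) \<in> bcontfun"
    proof (rule bcontfun_normI)
      show "continuous_on UNIV (\<lambda>x. (1 / w x) *\<^sub>R \<Psi> (E G) x)"
        using w0 by (intro continuous_intros w cont contE) auto
      show "norm ((1 / w x) *\<^sub>R \<Psi> (E G) x) \<le> C" for x
        using C[of x] w(2)[of x] by (simp add: field_simps)
    qed
    then show ?thesis unfolding \<Phi>_def by (simp add: Bcontfun_inverse)
  qed
  have "\<exists>!G. \<Phi> G = G"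
  proof (rule banach_fix_type[of _ \<Phi>, OF q], intro allI)
    fix G G'
    show "dist (\<Phi> G) (\<Phi> G') \<le> q * dist G G'"
    proof (rule dist_bound)
      fix x
      have "norm (\<Psi> (E G) x - \<Psi> (E G') x) \<le> q * dist G G' * w x"
      proof (rule contr[OF contE contE])
        fix y
        have "norm (E G y - E G' y) = w y * dist (G y) (G' y)"
          using w(2)[of y] by (simp add: E_def dist_norm flip: scaleR_diff_right)
        also have "\<dots> \<le> w y * dist G G'"
          using w(2)[of y] by (intro mult_left_mono dist_bounded) auto
        finally show "norm (E G y - E G' y) \<le> dist G G' * w y" by (simp add: mult.commute)
      qed
      then have "(1 / w x) * norm (\<Psi> (E G) x - \<Psi> (E G') x) \<le> q * dist G G'"
        using w(2)[of x] by (simp add: field_simps)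
      then show "dist (\<Phi> G x) (\<Phi> G' x) \<le> q * dist G G'"
        using w(2)[of x] by (simp add: appl dist_norm flip: scaleR_diff_right)
    qed
  qed
  then obtain G where G: "\<Phi> G = G" by blast
  have "\<Psi> (E G) x = E G x" for x
  proof -
    have "E G x = w x *\<^sub>R apply_bcontfun (\<Phi> G) x" using G by (simp add: E_def)
    then show ?thesis using w0[of x] by (simp add: appl)
  qed
  moreover have "\<exists>C. \<forall>x. norm (E G x) \<le> C * w x"
    using bdd[OF contE, of G] calculation by auto
  ultimately show ?thesis using contE by blast
qed

text \<open>Deterministic counterpart of \<open>stoch_exp\<close>: the functional f ->
  \<open>W i f \<omega>\<close> is replaced by the inner product with a vector
  \<open>z\<close>.\<close>

definition wexp :: "'h::real_inner \<Rightarrow> 'h \<Rightarrow> real" where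
  "wexp z g = exp (inner z g - (norm g)\<^sup>2 / 2)"

lemma wexp_pos: "wexp z g > 0" and wexp_le: "wexp z g \<le> exp (norm z * norm g)"
proof -
  show "wexp z g > 0" by (simp add: wexp_def)
  have "inner z g - (norm g)\<^sup>2 / 2 \<le> norm z * norm g"
    using norm_cauchy_schwarz[of z g] zero_le_power2[of "norm g"] by linarith
  then show "wexp z g \<le> exp (norm z * norm g)" by (simp add: wexp_def)
qed

lemma abs_wexp [simp]: "\<bar>wexp z g\<bar> = wexp z g"
  using wexp_pos[of z g] by simp

lemma continuous_on_wexp [continuous_intros]:
  "continuous_on S f \<Longrightarrow> continuous_on S g \<Longrightarrow> continuous_on S (\<lambda>x. wexp (f x) (g x))"
  unfolding wexp_def by (intro continuous_intros) auto

lemma norm_axis_real_inner: "norm (axis i (x::'h::real_inner) :: 'h ^ 'd::finite) = norm x"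
  by (simp add: norm_eq_sqrt_inner inner_axis_axis)

lemma continuous_on_axis [continuous_intros]:
  fixes f :: "'a::topological_space \<Rightarrow> 'h::real_normed_vector"
  assumes "continuous_on S f"
  shows "continuous_on S (\<lambda>x. axis i (f x) :: 'h ^ 'd::finite)"
proof -
  have "continuous_on S (\<lambda>x. if j = i then f x else 0)" for j
    using assms by (cases "j = i") auto
  then show ?thesis unfolding axis_def by (rule continuous_on_vec_lambda)
qed

text \<open>Source of the gain 1 / \<kappa> in the contraction constant.\<close>

lemma integral_exp_scaled_le:
  fixes \<tau> \<kappa> :: real
  assumes "\<kappa> > 0" "\<tau> \<ge> 0"
  shows "\<tau> * integral {0..1} (\<lambda>u. exp (\<kappa> * (\<tau> * u))) \<le> exp (\<kappa> * \<tau>) / \<kappa>"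
proof -
  have "((\<lambda>u. \<tau> * exp (\<kappa> * (\<tau> * u))) has_integral (exp (\<kappa> * (\<tau> * 1)) / \<kappa> - exp (\<kappa> * (\<tau> * 0)) / \<kappa>)) {0..1}"
  proof (rule fundamental_theorem_of_calculus)
    fix u
    show "((\<lambda>u. exp (\<kappa> * (\<tau> * u)) / \<kappa>) has_vector_derivative \<tau> * exp (\<kappa> * (\<tau> * u))) (at u within {0..1})"
      using assms unfolding has_real_derivative_iff_has_vector_derivative[symmetric]
      by (auto intro!: derivative_eq_intros)
  qed simp
  then have "\<tau> * integral {0..1} (\<lambda>u. exp (\<kappa> * (\<tau> * u))) = exp (\<kappa> * \<tau>) / \<kappa> - 1 / \<kappa>"
    by (simp add: integral_unique flip: integral_mult_right)
  then show ?thesis using assms by simp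
qed

text \<open>Over the fixed interval [0, 1] the integral is an ordinary parameter integral, so its
  joint continuity in time and z comes from continuity of the integrand.\<close>

lemma rescaled_integral_eq_LINT:
  fixes g :: "real \<Rightarrow> real"
  assumes "t \<ge> 0" "continuous_on {0..t} g"
  shows "set_integrable lborel {0..t} g"
    and "t * integral {0..1} (\<lambda>u. g (t * u)) = (LINT s:{0..t}|lborel. g s)"
proof -
  show i: "set_integrable lborel {0..t} g"
    using borel_integrable_atLeastAtMost'[OF assms(2)] .
  have "((\<lambda>u. t *\<^sub>R g (t * u)) has_integral (integral {t * 0..t * 1} g)) {0..1}"
    by (rule has_integral_substitution[where c = 0 and d = t])
       (use assms in \<open>auto intro!: derivative_eq_intros mult_left_le\<close>)
  then have "t * integral {0..1} (\<lambda>u. g (t * u)) = integral {0..t} g"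
    by (simp add: integral_unique flip: integral_mult_right)
  then show "t * integral {0..1} (\<lambda>u. g (t * u)) = (LINT s:{0..t}|lborel. g s)"
    using set_borel_integral_eq_integral(2)[OF i] by simp
qed

text \<open>The exponential growth bound is kept among the conclusions because it yields finite
  moments once \<open>z\<close> is Gaussian. Integrability is claimed separately since
  \<open>LINT\<close> of a non-integrable function is 0 by convention.\<close>

proposition wick_integral_equation:
  fixes b :: "real \<Rightarrow> real ^ 'd \<Rightarrow> real ^ 'd::finite"
    and \<Gamma> :: "'d \<Rightarrow> real \<Rightarrow> 'h::real_inner" and c :: "real ^ 'd"
  assumes T: "T > 0"
    and bcont: "continuous_on ({0..T} \<times> UNIV) (\<lambda>(t, x). b t x)"
    and bbd: "\<And>t x. t \<in> {0..T} \<Longrightarrow> norm (b t x) \<le> B"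
    and blip: "\<And>t x y. t \<in> {0..T} \<Longrightarrow> norm (b t x - b t y) \<le> L * norm (x - y)"
    and \<Gamma>0: "\<And>i. \<Gamma> i 0 = 0"
    and \<Gamma>lip: "\<And>i s t. 0 \<le> s \<Longrightarrow> s \<le> t \<Longrightarrow> t \<le> T \<Longrightarrow> norm (\<Gamma> i t - \<Gamma> i s) \<le> M * (t - s)"
  obtains F :: "real \<times> ('h ^ 'd) \<Rightarrow> real ^ 'd" and C A :: real where "continuous_on UNIV F"
    "\<And>t z. t \<in> {0..T} \<Longrightarrow> norm (F (t, z)) \<le> C * exp (A * norm z)"
    "\<And>t z i. t \<in> {0..T} \<Longrightarrow> set_integrable lborel {0..t} (\<lambda>s. b s (F (s, z - axis i (\<Gamma> i t - \<Gamma> i s))) $ i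
            * wexp (z $ i) (\<Gamma> i t - \<Gamma> i s))"
    "\<And>t z i. t \<in> {0..T} \<Longrightarrow> F (t, z) $ i = c $ i * wexp (z $ i) (\<Gamma> i t) +
        (LINT s:{0..t}|lborel. b s (F (s, z - axis i (\<Gamma> i t - \<Gamma> i s))) $ i * wexp (z $ i) (\<Gamma> i t - \<Gamma> i s))"
proof -
  \<comment> \<open>Clipping the time makes all functions live on a whole type, as the fixed point
    lemma requires; on [0, T] nothing changes.\<close>
  define \<tau> where "\<tau> t = max 0 (min T t)" for t
  have \<tau>: "0 \<le> \<tau> t" "\<tau> t \<le> T" for t using T by (auto simp: \<tau>_def)
  have \<tau>_id: "t \<in> {0..T} \<Longrightarrow> \<tau> t = t" for t by (auto simp: \<tau>_def)
  have \<tau>u: "0 \<le> \<tau> t * u" "\<tau> t * u \<le> \<tau> t" "\<tau> t * u \<le> T" if "u \<in> {0..1}" for t u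
    using that \<tau>[of t] by (auto intro: mult_left_le order_trans[OF mult_left_le])
  have \<tau>cont [continuous_intros]: "continuous_on S (\<lambda>x. \<tau> (f x))" if "continuous_on S f"
    for S and f :: "'x::topological_space \<Rightarrow> real"
    unfolding \<tau>_def using that by (intro continuous_intros)
  have B0: "B \<ge> 0" using bbd[of 0 undefined] T norm_ge_zero order_trans by (metis atLeastAtMost_iff less_imp_le order_refl)
  have "0 \<le> M * (T - 0)"
    using \<Gamma>lip[of 0 T undefined] T norm_ge_zero order_trans by (meson less_imp_le order_refl)
  then have M0: "M \<ge> 0" using T by (simp add: zero_le_mult_iff)
  have "0 \<le> norm (b 0 (axis undefined 1) - b 0 0)" by simp
  also have "\<dots> \<le> L * norm (axis undefined 1 - 0 :: real ^ 'd)" using blip[of 0 "axis undefined 1" 0] T by auto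
  finally have L0: "L \<ge> 0" by simp
  \<comment> \<open>\<open>E\<close> is the price of the shift in the weight. Summing over the
    components costs \<open>CARD('d)\<close>, so the contraction constant will be
    \<open>CARD('d) * L * E / \<kappa>\<close>, which this \<kappa> keeps below 1/2; the summand 1
    keeps \<kappa> positive when \<open>L\<close> is 0.\<close>
  define E where "E = exp (M * T * (M * T))"
  define \<kappa> where "\<kappa> = 2 * real CARD('d) * L * E + 1"
  have E0: "E > 0" by (simp add: E_def)
  have \<kappa>0: "\<kappa> > 0" using L0 E0 by (simp add: \<kappa>_def add_nonneg_pos)
  define I where "I F i t z u = b (\<tau> t * u) (F (\<tau> t * u, z - axis i (\<Gamma> i (\<tau> t) - \<Gamma> i (\<tau> t * u)))) $ i
            * wexp (z $ i) (\<Gamma> i (\<tau> t) - \<Gamma> i (\<tau> t * u))"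
    for F :: "real \<times> ('h ^ 'd) \<Rightarrow> real ^ 'd" and i t z u
  define \<Psi> :: "(real \<times> ('h ^ 'd) \<Rightarrow> real ^ 'd) \<Rightarrow> real \<times> ('h ^ 'd) \<Rightarrow> real ^ 'd" where
    "\<Psi> F p = (\<chi> i. c $ i * wexp (snd p $ i) (\<Gamma> i (\<tau> (fst p))) + \<tau> (fst p) * integral {0..1} (I F i (fst p) (snd p)))" for F p
  define w :: "real \<times> ('h ^ 'd) \<Rightarrow> real" where "w p = exp (\<kappa> * \<tau> (fst p) + M * \<tau> (fst p) * norm (snd p))" for p
  have \<Gamma>cont: "continuous_on {0..T} (\<Gamma> i)" for i
  proof (rule lipschitz_on_continuous_on, rule lipschitz_onI)
    fix s t assume "s \<in> {0..T}" "t \<in> {0..T}"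
    then show "dist (\<Gamma> i s) (\<Gamma> i t) \<le> M * dist s t"
      using \<Gamma>lip[of s t i] \<Gamma>lip[of t s i] by (cases "s \<le> t") (auto simp: dist_norm norm_minus_commute)
  qed (use M0 in auto)
  have \<Gamma>cont' [continuous_intros]: "continuous_on S (\<lambda>x. \<Gamma> i (f x))"
    if "continuous_on S f" "\<And>x. x \<in> S \<Longrightarrow> f x \<in> {0..T}" for S i and f :: "'x::topological_space \<Rightarrow> real"
    by (rule continuous_on_compose2[OF \<Gamma>cont that(1)]) (use that in auto)
  have bcont' [continuous_intros]: "continuous_on S (\<lambda>x. b (f x) (g x))"
    if "continuous_on S f" "continuous_on S g" "\<And>x. x \<in> S \<Longrightarrow> f x \<in> {0..T}"
    for S f and g :: "'x::topological_space \<Rightarrow> real ^ 'd"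
    using continuous_on_compose2[OF bcont continuous_on_Pair[OF that(1,2)]] that(3) by force
  have Fcont': "continuous_on S (\<lambda>x. F (g x))"
    if "continuous_on UNIV F" "continuous_on S g" for F :: "real \<times> ('h ^ 'd) \<Rightarrow> real ^ 'd" and S
    and g :: "'x::topological_space \<Rightarrow> real \<times> ('h ^ 'd)"
    by (rule continuous_on_compose2[OF that]) auto
  have Icont: "continuous_on (UNIV \<times> cbox 0 1) (\<lambda>(p, u). I F i (fst p) (snd p) u)"
    if F: "continuous_on UNIV F" for F i
    unfolding I_def split_beta using \<tau> \<tau>u
    by (intro continuous_intros Fcont'[OF F]) auto
  have Iint: "I F i t z integrable_on {0..1}" if F: "continuous_on UNIV F" for F i t z
  proof -
    have "continuous_on {0..1} (\<lambda>u. (\<lambda>(p, u). I F i (fst p) (snd p) u) ((t, z), u))"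
      by (rule continuous_on_compose2[OF Icont[OF F, of i]]) (auto intro!: continuous_intros)
    then show ?thesis by (auto intro: integrable_continuous_real)
  qed
  have wint: "wexp (z $ i) (\<Gamma> i (\<tau> t) - \<Gamma> i (\<tau> t * u)) \<le> exp (M * (\<tau> t - \<tau> t * u) * norm z)"
    if "u \<in> {0..1}" for z :: "'h ^ 'd" and t i u
  proof -
    have "norm (z $ i) * norm (\<Gamma> i (\<tau> t) - \<Gamma> i (\<tau> t * u)) \<le> norm z * (M * (\<tau> t - \<tau> t * u))"
      using \<tau>u[OF that, of t] \<tau>[of t] by (intro mult_mono Finite_Cartesian_Product.norm_nth_le \<Gamma>lip) auto
    then show ?thesis using wexp_le[of "z $ i" "\<Gamma> i (\<tau> t) - \<Gamma> i (\<tau> t * u)"]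
      by (smt (verit) exp_le_cancel_iff mult.commute)
  qed
  have "\<exists>F. continuous_on UNIV F \<and> (\<exists>C. \<forall>x. norm (F x) \<le> C * w x) \<and> \<Psi> F = F"
  proof (rule weighted_contraction_fixpoint[where q = "1/2"])
    show "continuous_on UNIV w" unfolding w_def by (intro continuous_intros)
    show "w x > 0" for x by (simp add: w_def)
    fix F :: "real \<times> ('h ^ 'd) \<Rightarrow> real ^ 'd" assume F: "continuous_on UNIV F"
    show "continuous_on UNIV (\<Psi> F)"
      unfolding \<Psi>_def
      using \<tau> integral_continuous_on_param[OF Icont[OF F]]
      by (intro continuous_on_vec_lambda continuous_intros) auto
    \<comment> \<open>As \<open>b\<close> is bounded by \<open>B\<close>, the constant does not
      depend on \<open>F\<close>.\<close>
    have "norm (\<Psi> F p) \<le> (real CARD('d) * (norm c + T * B)) * w p" for p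
    proof -
      obtain t z where p: "p = (t, z)" by fastforce
      have w1: "exp (M * \<tau> t * norm z) \<le> w p"
        using \<kappa>0 \<tau>[of t] by (simp add: w_def p)
      have "\<bar>\<Psi> F p $ i\<bar> \<le> (norm c + T * B) * w p" for i
      proof -
        have "\<bar>I F i t z u\<bar> \<le> B * w p" if u: "u \<in> {0..1}" for u
        proof -
          have "exp (M * (\<tau> t - \<tau> t * u) * norm z) \<le> exp (M * \<tau> t * norm z)"
            using M0 \<tau>u[OF u, of t] by (auto intro!: mult_right_mono mult_left_mono)
          moreover have "\<bar>b (\<tau> t * u) x $ i\<bar> \<le> B" for x
            using component_le_norm_cart[of "b (\<tau> t * u) x" i] bbd[of "\<tau> t * u" x] \<tau>u[OF u, of t]
            by auto
          moreover have "wexp (z $ i) (\<Gamma> i (\<tau> t) - \<Gamma> i (\<tau> t * u)) \<le> w p"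
            using wint[OF u, of z i t] w1 calculation(1) by linarith
          ultimately show ?thesis
            unfolding I_def abs_mult abs_wexp using B0
            by (intro mult_mono less_imp_le[OF wexp_pos])
        qed
        then have "norm (integral {0..1} (I F i t z)) \<le> integral {0..1} (\<lambda>u::real. B * w p)"
          using Iint[OF F] by (intro integral_norm_bound_integral) auto
        then have "norm (integral {0..1} (I F i t z)) \<le> B * w p" by simp
        moreover have "\<bar>c $ i * wexp (z $ i) (\<Gamma> i (\<tau> t))\<bar> \<le> norm c * w p"
        proof -
          have "wexp (z $ i) (\<Gamma> i (\<tau> t)) \<le> w p"
            using wint[of 0 z i t] w1 by (simp add: \<Gamma>0)
          then show ?thesis unfolding abs_mult abs_wexp
            by (intro mult_mono component_le_norm_cart less_imp_le[OF wexp_pos]) auto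
        qed
        moreover have "\<bar>\<tau> t * integral {0..1} (I F i t z)\<bar> \<le> T * (B * w p)"
          using \<tau>[of t] calculation(1) T unfolding abs_mult by (intro mult_mono) auto
        ultimately show ?thesis
          unfolding \<Psi>_def p by (simp add: distrib_right mult.assoc)
      qed
      then have "(\<Sum>i\<in>UNIV. \<bar>\<Psi> F p $ i\<bar>) \<le> (\<Sum>i\<in>(UNIV::'d set). (norm c + T * B) * w p)"
        by (intro sum_mono)
      then show ?thesis using norm_le_l1_cart[of "\<Psi> F p"] by simp
    qed
    then show "\<exists>C. \<forall>x. norm (\<Psi> F x) \<le> C * w x" by blast
    fix F' :: "real \<times> ('h ^ 'd) \<Rightarrow> real ^ 'd" and D and p :: "real \<times> ('h ^ 'd)" assume F': "continuous_on UNIV F'"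
      and D: "\<And>y. norm (F y - F' y) \<le> D * w y"
    obtain t z where p: "p = (t, z)" by fastforce
    have "w p > 0" by (simp add: w_def)
    then have D0: "D \<ge> 0" using D[of p] norm_ge_zero[of "F p - F' p"]
      by (metis mult_neg_pos not_le order_trans)
    \<comment> \<open>\<open>Q\<close> collects the factors free of the integration variable. What
      remains to integrate is the \<kappa> part of the weight alone.\<close>
    define Q where "Q = L * D * E * exp (M * \<tau> t * norm z)"
    have Q0: "Q \<ge> 0" using L0 D0 E0 by (simp add: Q_def)
    have "\<bar>\<Psi> F p $ i - \<Psi> F' p $ i\<bar> \<le> Q * (exp (\<kappa> * \<tau> t) / \<kappa>)" for i
    proof -
      have "norm (I F i t z u - I F' i t z u) \<le> Q * exp (\<kappa> * (\<tau> t * u))" if u: "u \<in> {0..1}" for u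
      proof -
        let ?s = "\<tau> t * u" and ?g = "\<Gamma> i (\<tau> t) - \<Gamma> i (\<tau> t * u)"
        let ?y = "(?s, z - axis i ?g)"
        note s = \<tau>u[OF u, of t]
        have [simp]: "\<tau> ?s = ?s" using s by (intro \<tau>_id) auto
        have "norm ?g \<le> M * (\<tau> t - ?s)" using s \<tau>[of t] by (intro \<Gamma>lip)
        also have "\<dots> \<le> M * T" using s \<tau>[of t] M0 by (intro mult_left_mono) auto
        finally have g: "norm ?g \<le> M * T" .
        have "norm (z - axis i ?g) \<le> norm z + norm ?g"
          using norm_triangle_ineq4[of z "axis i ?g"] by (simp add: norm_axis_real_inner)
        with g have nz: "norm (z - axis i ?g) \<le> norm z + M * T" by simp
        have "M * ?s * norm (z - axis i ?g) \<le> M * ?s * (norm z + M * T)"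
          using nz M0 s by (intro mult_left_mono) auto
        also have "\<dots> = M * ?s * norm z + M * ?s * (M * T)" by (simp add: distrib_left)
        also have "\<dots> \<le> M * ?s * norm z + M * T * (M * T)"
          using M0 s T by (intro add_left_mono mult_right_mono mult_left_mono) auto
        finally have wy: "w ?y \<le> exp (\<kappa> * ?s) * exp (M * ?s * norm z) * E"
          by (simp add: w_def E_def flip: exp_add)
        have "\<bar>b ?s (F ?y) $ i - b ?s (F' ?y) $ i\<bar> \<le> norm (b ?s (F ?y) - b ?s (F' ?y))"
          using component_le_norm_cart[of "b ?s (F ?y) - b ?s (F' ?y)" i] by simp
        also have "\<dots> \<le> L * norm (F ?y - F' ?y)" using s by (intro blip) auto
        also have "\<dots> \<le> L * (D * (exp (\<kappa> * ?s) * exp (M * ?s * norm z) * E))"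
          using L0 D[of ?y] wy D0 by (intro mult_left_mono order_trans[OF D] ) auto
        finally have "norm (I F i t z u - I F' i t z u) \<le>
            L * (D * (exp (\<kappa> * ?s) * exp (M * ?s * norm z) * E)) * exp (M * (\<tau> t - ?s) * norm z)"
          using wint[OF u, of z i t] wexp_pos[of "z $ i" ?g] L0 D0 E0
          unfolding I_def left_diff_distrib[symmetric] real_norm_def abs_mult
          by (intro mult_mono) (auto intro: less_imp_le)
        also have "\<dots> = L * D * E * exp (\<kappa> * ?s) * (exp (M * ?s * norm z) * exp (M * (\<tau> t - ?s) * norm z))"
          by (simp add: ac_simps)
        also have "exp (M * ?s * norm z) * exp (M * (\<tau> t - ?s) * norm z) = exp (M * \<tau> t * norm z)"
          by (simp add: algebra_simps flip: exp_add)
        finally show ?thesis by (simp add: Q_def ac_simps)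
      qed
      then have "norm (integral {0..1} (\<lambda>u. I F i t z u - I F' i t z u)) \<le>
          integral {0..1} (\<lambda>u. Q * exp (\<kappa> * (\<tau> t * u)))"
        by (intro integral_norm_bound_integral integrable_diff Iint F F')
           (auto intro!: integrable_continuous_real continuous_intros)
      then have "\<tau> t * norm (integral {0..1} (\<lambda>u. I F i t z u - I F' i t z u)) \<le>
          \<tau> t * (Q * integral {0..1} (\<lambda>u. exp (\<kappa> * (\<tau> t * u))))"
        using \<tau>[of t] by (intro mult_left_mono) auto
      also have "\<dots> = Q * (\<tau> t * integral {0..1} (\<lambda>u. exp (\<kappa> * (\<tau> t * u))))" by simp
      also have "\<dots> \<le> Q * (exp (\<kappa> * \<tau> t) / \<kappa>)"
        using Q0 \<tau>[of t] \<kappa>0 by (intro mult_left_mono integral_exp_scaled_le) auto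
      finally show ?thesis
        using \<tau>[of t] Iint[OF F] Iint[OF F']
        by (simp add: \<Psi>_def p integral_diff abs_mult flip: right_diff_distrib)
    qed
    then have "(\<Sum>i\<in>UNIV. \<bar>\<Psi> F p $ i - \<Psi> F' p $ i\<bar>) \<le> (\<Sum>i\<in>(UNIV::'d set). Q * (exp (\<kappa> * \<tau> t) / \<kappa>))"
      by (intro sum_mono)
    then have "norm (\<Psi> F p - \<Psi> F' p) \<le> real CARD('d) * (Q * (exp (\<kappa> * \<tau> t) / \<kappa>))"
      using norm_le_l1_cart[of "\<Psi> F p - \<Psi> F' p"] by simp
    also have "\<dots> = (real CARD('d) * L * E / \<kappa>) * D * w p"
      by (simp add: Q_def w_def p exp_add)
    also have "\<dots> \<le> 1 / 2 * D * w p"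
      using \<kappa>0 D0 \<open>w p > 0\<close> by (intro mult_right_mono) (auto simp: field_simps \<kappa>_def)
    finally show "norm (\<Psi> F p - \<Psi> F' p) \<le> 1 / 2 * D * w p" .
  qed auto
  then obtain F C where F: "continuous_on UNIV F" "\<And>x. norm (F x) \<le> C * w x" "\<Psi> F = F" by blast
  have C0: "C \<ge> 0" using F(2)[of undefined] by (metis w_def exp_gt_zero mult_neg_pos norm_ge_zero not_le order_trans)
  have contg: "continuous_on {0..t} (\<lambda>s. b s (F (s, z - axis i (\<Gamma> i t - \<Gamma> i s))) $ i
            * wexp (z $ i) (\<Gamma> i t - \<Gamma> i s))" if "t \<in> {0..T}" for t z i
    using that by (intro continuous_intros Fcont'[OF F(1)]) auto
  show ?thesis
  proof (rule that[of F "C * exp (\<kappa> * T)" "M * T"])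
    fix t assume t: "t \<in> {0..T}"
    fix z
    have "w (t, z) \<le> exp (\<kappa> * T) * exp (M * T * norm z)"
      using t M0 \<kappa>0 by (auto simp: w_def \<tau>_id simp flip: exp_add intro!: add_mono mult_left_mono mult_right_mono)
    then show "norm (F (t, z)) \<le> C * exp (\<kappa> * T) * exp (M * T * norm z)"
      using F(2)[of "(t, z)"] C0 by (smt (verit) mult.assoc mult_left_mono)
    fix i
    show "set_integrable lborel {0..t} (\<lambda>s. b s (F (s, z - axis i (\<Gamma> i t - \<Gamma> i s))) $ i
            * wexp (z $ i) (\<Gamma> i t - \<Gamma> i s))"
      using t by (intro rescaled_integral_eq_LINT contg) auto
    have "F (t, z) $ i = \<Psi> F (t, z) $ i" using F(3) by simp
    also have "\<dots> = c $ i * wexp (z $ i) (\<Gamma> i t) +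
        (LINT s:{0..t}|lborel. b s (F (s, z - axis i (\<Gamma> i t - \<Gamma> i s))) $ i * wexp (z $ i) (\<Gamma> i t - \<Gamma> i s))"
      using rescaled_integral_eq_LINT(2)[OF _ contg[OF t, of z i]] t
      by (simp add: \<Psi>_def \<tau>_id I_def[abs_def])
    finally show "F (t, z) $ i = \<dots>" .
  qed (rule F)
qed

section \<open>The kernel inner product\<close>

lemma L2_fun_bounded:
  assumes "set_borel_measurable lborel {0..T} f" "\<And>s. s \<in> {0..T} \<Longrightarrow> \<bar>f s\<bar> \<le> B"
  shows "f \<in> L2_fun T"
proof -
  have m: "(\<lambda>s. indicator {0..T} s *\<^sub>R f s) \<in> borel_measurable lborel"
    using assms(1) by (simp add: set_borel_measurable_def)
  have eq: "indicator {0..T} s *\<^sub>R (f s)\<^sup>2 = (indicator {0..T} s *\<^sub>R f s)\<^sup>2" for s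
    by (simp add: indicator_def)
  have "integrable lborel (\<lambda>s. (indicator {0..T} s *\<^sub>R f s)\<^sup>2)"
  proof (rule Bochner_Integration.integrable_bound)
    show "integrable lborel (\<lambda>s. B\<^sup>2 * indicator {0..T} s)"
      by (intro integrable_mult_right integrable_real_indicator) (auto simp: emeasure_lborel_Icc_eq)
    show "(\<lambda>s. (indicator {0..T} s *\<^sub>R f s)\<^sup>2) \<in> borel_measurable lborel" using m by measurable
    have "(f s)\<^sup>2 \<le> B\<^sup>2" if "s \<in> {0..T}" for s
      using assms(2)[OF that] by (simp add: abs_le_square_iff[symmetric])
    then show "AE s in lborel. norm ((indicator {0..T} s *\<^sub>R f s)\<^sup>2) \<le> norm (B\<^sup>2 * indicator {0..T} s)"
      by (auto simp: indicator_def)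
  qed
  with assms(1) show ?thesis unfolding L2_fun_def mem_Collect_eq set_integrable_def eq by simp
qed

lemma L2_fun_lincomb:
  assumes "f \<in> L2_fun T" "g \<in> L2_fun T"
  shows "(\<lambda>s. a * f s + b * g s) \<in> L2_fun T"
proof -
  let ?e = "\<lambda>h s. indicator {0..T} s *\<^sub>R (h s :: real)"
  have eq: "?e (\<lambda>s. (h s)\<^sup>2) s = (?e h s)\<^sup>2" for h s by (simp add: indicator_def)
  have lin: "?e (\<lambda>s. a * f s + b * g s) s = a * ?e f s + b * ?e g s" for s by (simp add: indicator_def)
  have [measurable]: "?e f \<in> borel_measurable lborel" "?e g \<in> borel_measurable lborel"
    using assms by (auto simp: L2_fun_def set_borel_measurable_def)
  have m: "(\<lambda>s. a * ?e f s + b * ?e g s) \<in> borel_measurable lborel" by measurable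
  have i: "integrable lborel (\<lambda>s. (?e f s)\<^sup>2)" "integrable lborel (\<lambda>s. (?e g s)\<^sup>2)"
    using assms unfolding eq[symmetric] by (auto simp: L2_fun_def set_integrable_def)
  have "integrable lborel (\<lambda>s. (a * ?e f s + b * ?e g s)\<^sup>2)"
  proof (rule Bochner_Integration.integrable_bound)
    show "integrable lborel (\<lambda>s. 2 * a\<^sup>2 * (?e f s)\<^sup>2 + 2 * b\<^sup>2 * (?e g s)\<^sup>2)" using i by simp
    have "(x + y)\<^sup>2 \<le> 2 * x\<^sup>2 + 2 * y\<^sup>2" for x y :: real
      using sum_squares_bound[of x y] by (simp add: power2_sum)
    from this[of "a * _" "b * _"]
    have "norm ((a * x + b * y)\<^sup>2) \<le> norm (2 * a\<^sup>2 * x\<^sup>2 + 2 * b\<^sup>2 * y\<^sup>2)" for x y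
      by (simp add: power_mult_distrib mult.assoc)
    then show "AE s in lborel. norm ((a * ?e f s + b * ?e g s)\<^sup>2) \<le> norm (2 * a\<^sup>2 * (?e f s)\<^sup>2 + 2 * b\<^sup>2 * (?e g s)\<^sup>2)"
      by blast
  qed measurable
  with m show ?thesis
    unfolding L2_fun_def mem_Collect_eq set_integrable_def set_borel_measurable_def eq lin by simp
qed

lemma L2_fun_indicator: "A \<in> sets borel \<Longrightarrow> indicator A \<in> L2_fun T"
  by (rule L2_fun_bounded[where B = 1]) (auto simp: set_borel_measurable_def indicator_def)

locale fractional_kernel =
  fixes T H :: real
  assumes T: "T > 0" and H: "1 / 2 < H" "H < 1"
begin

text \<open>The kernel as a function of the difference, cut off so that it is integrable on the real
  line. Translation invariance of \<open>lborel\<close> and Fubini on the whole plane then apply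
  without boundary terms.\<close>

definition kern :: "real \<Rightarrow> real" where
  "kern u = H * (2 * H - 1) * \<bar>u\<bar> powr (2 * H - 2) * indicator {-T..T} u"

abbreviation ext :: "(real \<Rightarrow> real) \<Rightarrow> real \<Rightarrow> real" where
  "ext f s \<equiv> indicator {0..T} s *\<^sub>R f s"

lemma kern_nonneg: "kern u \<ge> 0"
  using H by (simp add: kern_def)

lemma kern_minus: "kern (- u) = kern u"
  by (auto simp: kern_def indicator_def)

lemma kern_diff_eq: "s \<in> {0..T} \<Longrightarrow> t \<in> {0..T} \<Longrightarrow> phi_kernel H s t = kern (s - t)"
  by (auto simp: phi_kernel_def kern_def)

lemma measurable_kern [measurable]: "kern \<in> borel_measurable borel"
  unfolding kern_def[abs_def] by measurable

text \<open>The exponent 2 H - 2 exceeds -1 because H > 1/2. The half line is settled first, the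
  rest by reflection.\<close>

lemma integrable_kern: "integrable lborel kern"
proof -
  define f where "f u = indicator {0..T} u *\<^sub>R (u powr (2 * H - 2))" for u :: real
  have "(\<lambda>x. x powr (2 * H - 2)) integrable_on {0..T}"
    using has_integral_powr_from_0[of "2 * H - 2" T] H T by (auto simp: integrable_on_def)
  then have "integrable lebesgue f"
    using nonnegative_absolutely_integrable_1[of "\<lambda>x. x powr (2 * H - 2)" "{0..T}"]
    by (simp add: set_integrable_def f_def[abs_def])
  then have f: "integrable lborel f"
    by (subst (asm) integrable_completion) (auto simp: f_def[abs_def])
  have "integrable lborel (\<lambda>u. f (0 + (-1) * u))"
    by (rule lborel_integrable_real_affine[OF f]) simp
  then have "integrable lborel (\<lambda>u. H * (2 * H - 1) * (f u + f (- u)))" using f by simp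
  \<comment> \<open>At 0 both sides vanish, since \<open>0 powr\<close> anything is 0, so the two
    halves do not count that point twice.\<close>
  moreover have "kern = (\<lambda>u. H * (2 * H - 1) * (f u + f (- u)))"
    by (auto simp: kern_def f_def indicator_def fun_eq_iff)
  ultimately show ?thesis by simp
qed

lemma integrable_kern_shift: "integrable lborel (\<lambda>t. kern (s - t))"
  using lborel_integrable_real_affine[OF integrable_kern, of "-1" s] by simp

lemma integral_kern_shift: "(\<integral>t. kern (s - t) \<partial>lborel) = (\<integral>t. kern t \<partial>lborel)"
  using lborel_integral_real_affine[of "-1" kern s] by simp

lemma measurable_ext: "f \<in> L2_fun T \<Longrightarrow> ext f \<in> borel_measurable borel"
  by (auto simp: L2_fun_def set_borel_measurable_def)

lemma integrable_ext_sq: "f \<in> L2_fun T \<Longrightarrow> integrable lborel (\<lambda>s. (ext f s)\<^sup>2)"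
proof -
  have eq: "(ext f s)\<^sup>2 = indicator {0..T} s *\<^sub>R (f s)\<^sup>2" for s by (simp add: indicator_def)
  assume "f \<in> L2_fun T" then show ?thesis unfolding eq by (auto simp: L2_fun_def set_integrable_def)
qed

text \<open>Integrating out the variable that \<open>f\<close> does not see leaves the square
  integral of \<open>f\<close> times the constant integral of the kernel. The second claim follows
  by symmetry of the kernel.\<close>

lemma integrable_sq_kern:
  assumes f: "f \<in> L2_fun T"
  shows "integrable (lborel \<Otimes>\<^sub>M lborel) (\<lambda>p. (ext f (fst p))\<^sup>2 * kern (fst p - snd p))"
    and "integrable (lborel \<Otimes>\<^sub>M lborel) (\<lambda>p. (ext f (snd p))\<^sup>2 * kern (fst p - snd p))"
proof -
  note [measurable] = measurable_ext[OF f]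
  show i: "integrable (lborel \<Otimes>\<^sub>M lborel) (\<lambda>p. (ext f (fst p))\<^sup>2 * kern (fst p - snd p))"
  proof (rule lborel_pair.Fubini_integrable)
    have "(\<lambda>s. \<integral>t. norm ((ext f (fst (s, t)))\<^sup>2 * kern (fst (s, t) - snd (s, t))) \<partial>lborel)
        = (\<lambda>s. (ext f s)\<^sup>2 * (\<integral>t. kern t \<partial>lborel))"
      by (simp add: abs_mult kern_nonneg integral_kern_shift)
    then show "integrable lborel (\<lambda>s. \<integral>t. norm ((ext f (fst (s, t)))\<^sup>2 * kern (fst (s, t) - snd (s, t))) \<partial>lborel)"
      using integrable_ext_sq[OF f] by simp
    show "AE s in lborel. integrable lborel (\<lambda>t. (ext f (fst (s, t)))\<^sup>2 * kern (fst (s, t) - snd (s, t)))"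
      using integrable_kern_shift by auto
  qed measurable
  have "kern (t - s) = kern (s - t)" for s t using kern_minus[of "s - t"] by simp
  then show "integrable (lborel \<Otimes>\<^sub>M lborel) (\<lambda>p. (ext f (snd p))\<^sup>2 * kern (fst p - snd p))"
    using lborel_pair.integrable_product_swap[OF i] by (simp add: case_prod_unfold)
qed

text \<open>The product is dominated through 2 \<bar>x y\<bar> \<le> x^2 + y^2, as in Schur's test,
  so the kernel form is absolutely convergent on square integrable functions.\<close>

lemma integrable_prod_kern:
  assumes f: "f \<in> L2_fun T" and g: "g \<in> L2_fun T"
  shows "integrable (lborel \<Otimes>\<^sub>M lborel) (\<lambda>p. ext f (fst p) * ext g (snd p) * kern (fst p - snd p))"
proof (rule Bochner_Integration.integrable_bound)
  note [measurable] = measurable_ext[OF f] measurable_ext[OF g]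
  show "integrable (lborel \<Otimes>\<^sub>M lborel)
      (\<lambda>p. (ext f (fst p))\<^sup>2 * kern (fst p - snd p) + (ext g (snd p))\<^sup>2 * kern (fst p - snd p))"
    by (intro Bochner_Integration.integrable_add integrable_sq_kern f g)
  show "(\<lambda>p. ext f (fst p) * ext g (snd p) * kern (fst p - snd p)) \<in> borel_measurable (lborel \<Otimes>\<^sub>M lborel)"
    by measurable
  have "\<bar>x * y\<bar> \<le> x\<^sup>2 + y\<^sup>2" for x y :: real
    using sum_squares_bound[of "\<bar>x\<bar>" "\<bar>y\<bar>", unfolded power2_abs mult.assoc]
      mult_nonneg_nonneg[OF abs_ge_zero abs_ge_zero, of x y]
    unfolding abs_mult by linarith
  then have "\<bar>x * y\<bar> * kern u \<le> (x\<^sup>2 + y\<^sup>2) * kern u" for x y u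
    using kern_nonneg by (intro mult_right_mono)
  then have "norm (x * y * kern u) \<le> norm (x\<^sup>2 * kern u + y\<^sup>2 * kern u)" for x y u
    by (simp add: abs_mult kern_nonneg distrib_right)
  then show "AE p in lborel \<Otimes>\<^sub>M lborel. norm (ext f (fst p) * ext g (snd p) * kern (fst p - snd p)) \<le>
      norm ((ext f (fst p))\<^sup>2 * kern (fst p - snd p) + (ext g (snd p))\<^sup>2 * kern (fst p - snd p))"
    by (intro AE_I2)
qed

section \<open>The kernel operator on square integrable functions\<close>

lemma phi_integral_eq:
  "t \<in> {0..T} \<Longrightarrow> phi_integral H T u t = (\<integral>s. ext u s * kern (t - s) \<partial>lborel)"
  unfolding phi_integral_def set_lebesgue_integral_def
  by (intro Bochner_Integration.integral_cong) (auto simp: indicator_def kern_diff_eq)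

lemma phi_inner_eq_phi_integral:
  "phi_inner H T f g = (LINT s:{0..T}|lborel. f s * phi_integral H T g s)"
proof -
  have "(LINT t:{0..T}|lborel. f s * g t * phi_kernel H s t) = f s * phi_integral H T g s" for s
    unfolding phi_integral_def by (simp add: mult.assoc)
  then show ?thesis unfolding phi_inner_def by simp
qed

lemma phi_inner_eq:
  assumes f: "f \<in> L2_fun T" and g: "g \<in> L2_fun T"
  shows "phi_inner H T f g =
    (\<integral>p. ext f (fst p) * ext g (snd p) * kern (fst p - snd p) \<partial>(lborel \<Otimes>\<^sub>M lborel))"
proof -
  have "phi_inner H T f g = (\<integral>s. (\<integral>t. ext f s * ext g t * kern (s - t) \<partial>lborel) \<partial>lborel)"
    unfolding phi_inner_eq_phi_integral set_lebesgue_integral_def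
  proof (intro Bochner_Integration.integral_cong refl)
    fix s
    show "ext (\<lambda>s. f s * phi_integral H T g s) s = (\<integral>t. ext f s * ext g t * kern (s - t) \<partial>lborel)"
      by (cases "s \<in> {0..T}") (auto simp: phi_integral_eq mult.assoc)
  qed
  also have "\<dots> = (\<integral>p. ext f (fst p) * ext g (snd p) * kern (fst p - snd p) \<partial>(lborel \<Otimes>\<^sub>M lborel))"
    using lborel_pair.integral_fst'[OF integrable_prod_kern[OF f g]] by simp
  finally show ?thesis .
qed

lemma L2_fun_one: "(\<lambda>_. 1) \<in> L2_fun T"
  by (rule L2_fun_bounded[where B = 1]) (auto simp: set_borel_measurable_def)

text \<open>Pairing with the constant 1 turns both claims into Fubini for
  \<open>integrable_prod_kern\<close>.\<close>

lemma phi_integral_integrable: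
  assumes u: "u \<in> L2_fun T"
  shows "set_integrable lborel {0..T} (phi_integral H T u)"
    and "AE t in lborel. t \<in> {0..T} \<longrightarrow> integrable lborel (\<lambda>s. ext u s * kern (t - s))"
proof -
  note i = integrable_prod_kern[OF L2_fun_one u]
  have "ext (phi_integral H T u) t = (\<integral>s. ext (\<lambda>_. 1) t * ext u s * kern (t - s) \<partial>lborel)" for t
    by (cases "t \<in> {0..T}") (auto simp: phi_integral_eq mult.assoc)
  then show "set_integrable lborel {0..T} (phi_integral H T u)"
    using lborel_pair.integrable_fst'[OF i] by (simp add: set_integrable_def)
  show "AE t in lborel. t \<in> {0..T} \<longrightarrow> integrable lborel (\<lambda>s. ext u s * kern (t - s))"
    using lborel_pair.AE_integrable_fst'[OF i]
  proof eventually_elim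
    case (elim t)
    then show ?case by (cases "t \<in> {0..T}") auto
  qed
qed

text \<open>The exceptional t are those where one of the integrals diverges and \<open>LINT\<close>
  takes its default value 0.\<close>

lemma phi_integral_lincomb:
  assumes u: "u \<in> L2_fun T" and v: "v \<in> L2_fun T"
  shows "AE t in lborel. t \<in> {0..T} \<longrightarrow>
    phi_integral H T (\<lambda>s. a * u s + b * v s) t = a * phi_integral H T u t + b * phi_integral H T v t"
  using phi_integral_integrable(2)[OF u] phi_integral_integrable(2)[OF v]
proof eventually_elim
  case (elim t)
  show ?case
  proof
    assume t: "t \<in> {0..T}"
    have "(\<lambda>s. ext (\<lambda>s. a * u s + b * v s) s * kern (t - s)) =
        (\<lambda>s. a * (ext u s * kern (t - s)) + b * (ext v s * kern (t - s)))"
      by (auto simp: algebra_simps)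
    with elim t show "phi_integral H T (\<lambda>s. a * u s + b * v s) t =
        a * phi_integral H T u t + b * phi_integral H T v t"
      by (simp add: phi_integral_eq)
  qed
qed

text \<open>Carries pointwise dominated limits of functions into limits for the kernel seminorm; all
  approximations in the completion rest on it.\<close>

lemma phi_inner_dominated:
  fixes g :: "nat \<Rightarrow> real \<Rightarrow> real"
  assumes g: "\<And>n. g n \<in> L2_fun T" and w: "w \<in> L2_fun T"
    and bd: "\<And>n s. s \<in> {0..T} \<Longrightarrow> \<bar>g n s\<bar> \<le> w s"
    and lim: "\<And>s. s \<in> {0..T} \<Longrightarrow> (\<lambda>n. g n s) \<longlonglongrightarrow> 0"
  shows "(\<lambda>n. phi_inner H T (g n) (g n)) \<longlonglongrightarrow> 0"
proof -
  let ?M = "lborel \<Otimes>\<^sub>M lborel :: (real \<times> real) measure"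
  note [measurable] = measurable_ext[OF g] measurable_ext[OF w]
  have l: "(\<lambda>n. ext (g n) s) \<longlonglongrightarrow> 0" for s
    using lim[of s] by (cases "s \<in> {0..T}") auto
  have b: "\<bar>ext (g n) s\<bar> \<le> ext w s" for n s
    using bd[of s n] by (cases "s \<in> {0..T}") auto
  have "(\<lambda>n. \<integral>p. ext (g n) (fst p) * ext (g n) (snd p) * kern (fst p - snd p) \<partial>?M) \<longlonglongrightarrow> (\<integral>p. 0 \<partial>?M)"
  proof (rule integral_dominated_convergence)
    show "integrable ?M (\<lambda>p. ext w (fst p) * ext w (snd p) * kern (fst p - snd p))"
      by (rule integrable_prod_kern[OF w w])
    show "(\<lambda>p. ext (g n) (fst p) * ext (g n) (snd p) * kern (fst p - snd p)) \<in> borel_measurable ?M" for n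
      by measurable
    show "AE p in ?M. (\<lambda>n. ext (g n) (fst p) * ext (g n) (snd p) * kern (fst p - snd p)) \<longlonglongrightarrow> 0"
    proof (rule AE_I2)
      fix p :: "real \<times> real"
      show "(\<lambda>n. ext (g n) (fst p) * ext (g n) (snd p) * kern (fst p - snd p)) \<longlonglongrightarrow> 0"
        using tendsto_mult[OF tendsto_mult[OF l[of "fst p"] l[of "snd p"]] tendsto_const[of "kern (fst p - snd p)"]]
        by simp
    qed
    show "AE p in ?M. norm (ext (g n) (fst p) * ext (g n) (snd p) * kern (fst p - snd p)) \<le>
        ext w (fst p) * ext w (snd p) * kern (fst p - snd p)" for n
      unfolding real_norm_def abs_mult abs_of_nonneg[OF kern_nonneg]
      by (rule AE_I2, rule mult_right_mono[OF _ kern_nonneg], rule mult_mono)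
         (auto intro: b order_trans[OF abs_ge_zero b] simp del: real_scaleR_def)
  qed measurable
  then show ?thesis by (simp add: phi_inner_eq[OF g g])
qed

end

section \<open>The completion\<close>

lemma subspace_closure:
  fixes S :: "'a::real_normed_vector set"
  assumes S: "subspace S"
  shows "subspace (closure S)"
proof (rule subspaceI)
  show "0 \<in> closure S" using subspace_0[OF S] closure_subset by blast
next
  fix x y assume "x \<in> closure S" "y \<in> closure S"
  then obtain f g where "\<And>n. f n \<in> S" "f \<longlonglongrightarrow> x" "\<And>n. g n \<in> S" "g \<longlonglongrightarrow> y"
    unfolding closure_sequential by blast
  then have "\<forall>n. f n + g n \<in> S" "(\<lambda>n. f n + g n) \<longlonglongrightarrow> x + y"
    using subspace_add[OF S] by (auto intro: tendsto_add)
  then show "x + y \<in> closure S" unfolding closure_sequential by (intro exI conjI)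
next
  fix c x assume "x \<in> closure S"
  then obtain f where "\<And>n. f n \<in> S" "f \<longlonglongrightarrow> x"
    unfolding closure_sequential by blast
  then have "\<forall>n. c *\<^sub>R f n \<in> S" "(\<lambda>n. c *\<^sub>R f n) \<longlonglongrightarrow> c *\<^sub>R x"
    using subspace_scale[OF S] by (auto intro: tendsto_scaleR)
  then show "c *\<^sub>R x \<in> closure S" unfolding closure_sequential by (intro exI conjI)
qed

locale phi_hilbert = fractional_kernel T H for T H :: real +
  fixes \<iota> :: "(real \<Rightarrow> real) \<Rightarrow> 'h::{real_inner,complete_space}"
  assumes completion: "phi_completion H T \<iota>"
begin

lemma iota_lincomb:
  "f \<in> L2_fun T \<Longrightarrow> g \<in> L2_fun T \<Longrightarrow> \<iota> (\<lambda>s. a * f s + b * g s) = a *\<^sub>R \<iota> f + b *\<^sub>R \<iota> g"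
  and iota_inner: "f \<in> L2_fun T \<Longrightarrow> g \<in> L2_fun T \<Longrightarrow> inner (\<iota> f) (\<iota> g) = phi_inner H T f g"
  and iota_dense: "closure (\<iota> ` L2_fun T) = UNIV"
  using completion unfolding phi_completion_def by blast+

lemma L2_fun_diff: "f \<in> L2_fun T \<Longrightarrow> g \<in> L2_fun T \<Longrightarrow> (\<lambda>s. f s - g s) \<in> L2_fun T"
  using L2_fun_lincomb[of f T g 1 "-1"] by simp

lemma iota_diff:
  assumes "f \<in> L2_fun T" "g \<in> L2_fun T"
  shows "\<iota> (\<lambda>s. f s - g s) = \<iota> f - \<iota> g"
  using iota_lincomb[OF assms, of 1 "-1"] by simp

lemma L2_fun_scale: "f \<in> L2_fun T \<Longrightarrow> (\<lambda>s. a * f s) \<in> L2_fun T"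
  using L2_fun_lincomb[of f T f a 0] by simp

lemma iota_scale: "f \<in> L2_fun T \<Longrightarrow> \<iota> (\<lambda>s. a * f s) = a *\<^sub>R \<iota> f"
  using iota_lincomb[of f f a 0] by simp

lemma L2_fun_add: "f \<in> L2_fun T \<Longrightarrow> g \<in> L2_fun T \<Longrightarrow> (\<lambda>s. f s + g s) \<in> L2_fun T"
  using L2_fun_lincomb[of f T g 1 1] by simp

lemma iota_add:
  "f \<in> L2_fun T \<Longrightarrow> g \<in> L2_fun T \<Longrightarrow> \<iota> (\<lambda>s. f s + g s) = \<iota> f + \<iota> g"
  using iota_lincomb[of f g 1 1] by simp

lemma L2_fun_zero: "(\<lambda>_. 0) \<in> L2_fun T"
  using L2_fun_scale[OF L2_fun_one, of 0] by simp

lemma iota_zero: "\<iota> (\<lambda>_. 0) = 0"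
  using iota_scale[OF L2_fun_one, of 0] by simp

lemma
  assumes "finite J" "\<And>j. j \<in> J \<Longrightarrow> f j \<in> L2_fun T"
  shows L2_fun_sum: "(\<lambda>s. \<Sum>j\<in>J. f j s) \<in> L2_fun T"
    and iota_sum: "\<iota> (\<lambda>s. \<Sum>j\<in>J. f j s) = (\<Sum>j\<in>J. \<iota> (f j))"
proof -
  have "(\<lambda>s. \<Sum>j\<in>J. f j s) \<in> L2_fun T \<and> \<iota> (\<lambda>s. \<Sum>j\<in>J. f j s) = (\<Sum>j\<in>J. \<iota> (f j))"
    using assms by (induction J) (auto simp: L2_fun_zero iota_zero L2_fun_add iota_add)
  then show "(\<lambda>s. \<Sum>j\<in>J. f j s) \<in> L2_fun T" "\<iota> (\<lambda>s. \<Sum>j\<in>J. f j s) = (\<Sum>j\<in>J. \<iota> (f j))"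
    by blast+
qed

section \<open>Limits in the completion and density of step functions\<close>

lemma norm_iota_diff:
  "f \<in> L2_fun T \<Longrightarrow> g \<in> L2_fun T \<Longrightarrow>
    (norm (\<iota> f - \<iota> g))\<^sup>2 = phi_inner H T (\<lambda>s. f s - g s) (\<lambda>s. f s - g s)"
  by (simp add: power2_norm_eq_inner iota_diff[symmetric] iota_inner L2_fun_diff)

lemma iota_dominated:
  assumes g: "\<And>n. g n \<in> L2_fun T" and f: "f \<in> L2_fun T" and w: "w \<in> L2_fun T"
    and bd: "\<And>n s. s \<in> {0..T} \<Longrightarrow> \<bar>g n s - f s\<bar> \<le> w s"
    and lim: "\<And>s. s \<in> {0..T} \<Longrightarrow> (\<lambda>n. g n s) \<longlonglongrightarrow> f s"
  shows "(\<lambda>n. \<iota> (g n)) \<longlonglongrightarrow> \<iota> f"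
proof -
  have "(\<lambda>n. phi_inner H T (\<lambda>s. g n s - f s) (\<lambda>s. g n s - f s)) \<longlonglongrightarrow> 0"
    using bd lim[THEN LIM_zero] by (intro phi_inner_dominated[OF L2_fun_diff[OF g f] w])
  then have "(\<lambda>n. (norm (\<iota> (g n) - \<iota> f))\<^sup>2) \<longlonglongrightarrow> 0"
    by (simp add: norm_iota_diff g f)
  then have "(\<lambda>n. sqrt ((norm (\<iota> (g n) - \<iota> f))\<^sup>2)) \<longlonglongrightarrow> sqrt 0"
    by (rule tendsto_real_sqrt)
  then have "(\<lambda>n. norm (\<iota> (g n) - \<iota> f)) \<longlonglongrightarrow> 0" by simp
  then show ?thesis using tendsto_norm_zero_iff LIM_zero_iff by blast
qed

text \<open>Lets representatives be changed off [0, T], for instance a half line against an interval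
  starting at 0. The proof reads a constant sequence as one converging to
  \<open>\<iota> g\<close>.\<close>

lemma iota_cong:
  assumes f: "f \<in> L2_fun T" and g: "g \<in> L2_fun T" and eq: "\<And>s. s \<in> {0..T} \<Longrightarrow> f s = g s"
  shows "\<iota> f = \<iota> g"
proof -
  have "(\<lambda>n::nat. \<iota> f) \<longlonglongrightarrow> \<iota> g"
    by (rule iota_dominated[OF f g L2_fun_zero]) (use eq in auto)
  then show ?thesis by (simp add: LIMSEQ_const_iff)
qed

text \<open>The integrands whose Wiener integral is determined by the values of the path: closed
  span of those for which it is prescribed.\<close>

definition steps :: "'h set" where
  "steps = closure (span ((\<lambda>t. \<iota> (indicator {0..t})) ` {0..T}))"

lemma steps_closed: "(\<And>n::nat. x n \<in> steps) \<Longrightarrow> x \<longlonglongrightarrow> l \<Longrightarrow> l \<in> steps"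
  unfolding steps_def using closed_sequentially[OF closed_closure] by blast

lemma steps_subspace: "subspace steps"
  unfolding steps_def by (rule subspace_closure) simp

text \<open>A Dynkin argument. Half lines are stable under intersection and meet [0, T] in the
  generating intervals; complements subtract from the constant 1, which is the interval [0, T];
  disjoint unions are dominated limits of finite sums and \<open>steps\<close> is closed.\<close>

lemma indicator_in_steps:
  assumes "A \<in> sets borel"
  shows "\<iota> (indicator A) \<in> steps"
proof -
  have gen: "\<iota> (indicator {0..t}) \<in> steps" if "t \<in> {0..T}" for t
    unfolding steps_def using that by (intro closure_subset[THEN subsetD] span_base) auto
  have one: "\<iota> (\<lambda>_. 1) \<in> steps"
    using gen[of T] T iota_cong[OF L2_fun_one L2_fun_indicator, of "{0..T}"] by auto
  have "Int_stable (range (\<lambda>a::real. {..a}))" by (auto simp: Int_stable_def)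
  moreover have "range (\<lambda>a::real. {..a}) \<subseteq> Pow UNIV" by simp
  moreover have "A \<in> sigma_sets UNIV (range (\<lambda>a::real. {..a}))"
    using assms by (subst (asm) borel_eq_atMost) simp
  ultimately show ?thesis
  proof (induction rule: sigma_sets_induct_disjoint)
    case (basic A)
    then obtain a where A: "A = {..a}" by auto
    consider "a < 0" | "a \<in> {0..T}" | "a > T" by fastforce
    then show ?case
    proof cases
      case 1
      then have "\<iota> (indicator A) = \<iota> (\<lambda>_. 0)"
        by (intro iota_cong L2_fun_indicator L2_fun_zero) (auto simp: A)
      then show ?thesis by (simp add: iota_zero subspace_0[OF steps_subspace])
    next
      case 2
      then have "\<iota> (indicator A) = \<iota> (indicator {0..a})"
        by (intro iota_cong L2_fun_indicator L2_fun_zero) (auto simp: A indicator_def)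
      then show ?thesis using gen[OF 2] by simp
    next
      case 3
      then have "\<iota> (indicator A) = \<iota> (\<lambda>_. 1)"
        by (intro iota_cong L2_fun_indicator L2_fun_one) (auto simp: A)
      then show ?thesis using one by simp
    qed
  next
    case empty
    have "indicator {} = (\<lambda>_. 0 :: real)" by auto
    then show ?case by (simp add: iota_zero subspace_0[OF steps_subspace])
  next
    case (compl A)
    then have A: "A \<in> sets borel" by (subst borel_eq_atMost) simp
    have "indicator (UNIV - A) = (\<lambda>s. 1 - indicator A s :: real)" by (auto simp: indicator_def)
    then have "\<iota> (indicator (UNIV - A)) = \<iota> (\<lambda>_. 1) - \<iota> (indicator A)"
      by (simp add: iota_diff L2_fun_one L2_fun_indicator A)
    then show ?case using subspace_diff[OF steps_subspace one compl(2)] by simp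
  next
    case (union A)
    then have A: "A n \<in> sets borel" for n by (subst borel_eq_atMost) auto
    show ?case
    proof (rule steps_closed)
      show "\<iota> (\<lambda>s. \<Sum>i<n. indicator (A i) s) \<in> steps" for n
        using union(3) by (simp add: iota_sum L2_fun_indicator A subspace_sum[OF steps_subspace])
      have eq: "(\<Sum>i<n. indicator (A i) s) = (indicator (\<Union>i<n. A i) s :: real)" for n s
        using union(1) by (intro indicator_UN_disjoint[symmetric]) (auto simp: disjoint_family_on_def)
      show "(\<lambda>n. \<iota> (\<lambda>s. \<Sum>i<n. indicator (A i) s)) \<longlonglongrightarrow> \<iota> (indicator (\<Union>i. A i))"
      proof (rule iota_dominated[OF _ _ L2_fun_one])
        show "(\<lambda>n. \<Sum>i<n. indicator (A i) s) \<longlonglongrightarrow> (indicator (\<Union>i. A i) s :: real)" for s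
          unfolding eq by (rule LIMSEQ_indicator_UN)
        show "\<bar>(\<Sum>i<n. indicator (A i) s) - indicator (\<Union>i. A i) s\<bar> \<le> (1::real)" for n s
          unfolding eq by (auto simp: indicator_def)
      qed (auto intro!: L2_fun_sum L2_fun_indicator A)
    qed
  qed
qed

lemma steps_UNIV: "steps = UNIV"
proof -
  have "\<iota> f \<in> steps" if f: "f \<in> L2_fun T" for f
  proof -
    have m: "ext f \<in> borel_measurable borel" by (rule measurable_ext[OF f])
    \<comment> \<open>The simple functions are bounded by 2 \<bar>f\<bar>, so the error is at most 3
      \<bar>f\<bar>, the dominating function used below.\<close>
    obtain F where F: "\<And>i. simple_function borel (F i)" "\<And>x. (\<lambda>i. F i x) \<longlonglongrightarrow> ext f x"
      "\<And>i x. dist (F i x) 0 \<le> 2 * dist (ext f x) 0"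
      using borel_measurable_implies_sequence_metric[OF m, of 0] by auto
    have eq: "F i = (\<lambda>s. \<Sum>y\<in>range (F i). y * indicator (F i -` {y}) s)" for i
    proof
      fix s show "F i s = (\<Sum>y\<in>range (F i). y * indicator (F i -` {y}) s)"
        using simple_function_indicator_representation_banach[OF F(1)[of i], of s]
        by (simp only: space_borel UNIV_I Int_UNIV_right real_scaleR_def mult.commute simp_thms)
    qed
    have fin: "finite (range (F i))" for i using F(1)[of i] by (simp add: simple_function_def)
    have meas: "F i -` {y} \<in> sets borel" for i y
      using simple_functionD(2)[OF F(1)[of i], of "{y}"] by simp
    have FL: "F i \<in> L2_fun T" and FV: "\<iota> (F i) \<in> steps" for i
    proof -
      show "F i \<in> L2_fun T"
        by (subst eq) (intro L2_fun_sum fin L2_fun_scale L2_fun_indicator meas)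
      have "\<iota> (F i) = \<iota> (\<lambda>s. \<Sum>y\<in>range (F i). y * indicator (F i -` {y}) s)" by (subst eq) simp
      also have "\<dots> = (\<Sum>y\<in>range (F i). y *\<^sub>R \<iota> (indicator (F i -` {y})))"
        by (subst iota_sum[OF fin])
           (simp_all add: L2_fun_scale L2_fun_indicator iota_scale[OF L2_fun_indicator] meas)
      also have "\<dots> \<in> steps"
        by (intro subspace_sum[OF steps_subspace] subspace_scale[OF steps_subspace] indicator_in_steps meas)
      finally show "\<iota> (F i) \<in> steps" .
    qed
    have absL: "(\<lambda>s. \<bar>f s\<bar>) \<in> L2_fun T"
    proof -
      have "ext (\<lambda>s. \<bar>f s\<bar>) = (\<lambda>s. \<bar>ext f s\<bar>)" by (auto simp: indicator_def)
      moreover have "(\<lambda>s. \<bar>ext f s\<bar>) \<in> borel_measurable borel" using m by measurable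
      ultimately show ?thesis using f by (simp add: L2_fun_def set_borel_measurable_def)
    qed
    have "(\<lambda>i. \<iota> (F i)) \<longlonglongrightarrow> \<iota> f"
    proof (rule iota_dominated[OF FL f L2_fun_scale[OF absL, of 3]])
      fix s assume s: "s \<in> {0..T}"
      show "(\<lambda>i. F i s) \<longlonglongrightarrow> f s" using F(2)[of s] s by simp
      show "\<bar>F n s - f s\<bar> \<le> 3 * \<bar>f s\<bar>" for n using F(3)[of n s] s by simp
    qed
    then show ?thesis by (rule steps_closed[OF FV])
  qed
  then have "closure (\<iota> ` L2_fun T) \<subseteq> steps"
    by (intro closure_minimal) (auto simp: steps_def)
  then show ?thesis using iota_dense by auto
qed

text \<open>For \<open>u n\<close> in place of \<open>f\<close> this is the definition of the inner
  product. The left side is continuous in the completion and, \<open>g\<close> being bounded, the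
  right side is continuous for the L1 convergence in \<open>is_Phi\<close>. It yields both the shift
  paths and the coefficients of the projections.\<close>

lemma is_Phi_inner:
  assumes f: "is_Phi H T \<iota> f h" and g: "set_borel_measurable lborel {0..T} g"
    and bd: "\<And>s. s \<in> {0..T} \<Longrightarrow> \<bar>g s\<bar> \<le> B"
  shows "inner (\<iota> g) f = (LINT s:{0..T}|lborel. g s * h s)"
proof -
  obtain u where u: "\<And>n. u n \<in> L2_fun T" "(\<lambda>n. \<iota> (u n)) \<longlonglongrightarrow> f"
    "(\<lambda>n. LINT t:{0..T}|lborel. \<bar>phi_integral H T (u n) t - h t\<bar>) \<longlonglongrightarrow> 0"
    and h: "set_integrable lborel {0..T} h"
    using f unfolding is_Phi_def by blast
  have gL: "g \<in> L2_fun T" by (rule L2_fun_bounded[OF g bd])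
  have i: "set_integrable lborel {0..T} (\<lambda>s. g s * k s)" if k: "set_integrable lborel {0..T} k" for k
    unfolding set_integrable_def
  proof (rule Bochner_Integration.integrable_bound)
    show "integrable lborel (\<lambda>s. B * ext k s)" using k by (simp add: set_integrable_def)
    have "(\<lambda>s. ext g s * ext k s) \<in> borel_measurable lborel"
      using g k unfolding set_borel_measurable_def set_integrable_def by measurable
    moreover have "(\<lambda>s. ext g s * ext k s) = ext (\<lambda>s. g s * k s)" by (auto simp: indicator_def)
    ultimately show "ext (\<lambda>s. g s * k s) \<in> borel_measurable lborel" by simp
    have "norm (ext (\<lambda>s. g s * k s) s) \<le> norm (B * ext k s)" for s
      using bd[of s] by (auto simp: indicator_def abs_mult intro!: mult_right_mono)
    then show "AE s in lborel. norm (ext (\<lambda>s. g s * k s) s) \<le> norm (B * ext k s)" by blast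
  qed
  note p = phi_integral_integrable(1)[OF u(1)]
  have "norm (inner (\<iota> g) (\<iota> (u n)) - (LINT s:{0..T}|lborel. g s * h s)) \<le>
      (LINT t:{0..T}|lborel. \<bar>phi_integral H T (u n) t - h t\<bar>) * B" for n
  proof -
    have d: "set_integrable lborel {0..T} (\<lambda>s. phi_integral H T (u n) s - h s)"
      using p h by (rule set_integral_diff)
    have "inner (\<iota> g) (\<iota> (u n)) - (LINT s:{0..T}|lborel. g s * h s) =
        (LINT s:{0..T}|lborel. g s * phi_integral H T (u n) s - g s * h s)"
      using i[OF p] i[OF h] by (simp add: iota_inner gL u(1) phi_inner_eq_phi_integral set_integral_diff)
    also have "norm \<dots> \<le> (LINT s:{0..T}|lborel. norm (g s * phi_integral H T (u n) s - g s * h s))"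
      by (intro set_integral_norm_bound set_integral_diff i p h)
    also have "\<dots> \<le> (LINT s:{0..T}|lborel. B * \<bar>phi_integral H T (u n) s - h s\<bar>)"
    proof (rule set_integral_mono)
      show "set_integrable lborel {0..T} (\<lambda>s. norm (g s * phi_integral H T (u n) s - g s * h s))"
        by (intro set_integrable_norm set_integral_diff i p h)
      show "set_integrable lborel {0..T} (\<lambda>s. B * \<bar>phi_integral H T (u n) s - h s\<bar>)"
        using set_integrable_abs[OF d] by simp
      show "norm (g s * phi_integral H T (u n) s - g s * h s) \<le> B * \<bar>phi_integral H T (u n) s - h s\<bar>"
        if "s \<in> {0..T}" for s
        using bd[OF that] by (simp add: abs_mult mult_right_mono flip: right_diff_distrib)
    qed
    finally show ?thesis by (simp add: mult.commute)
  qed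
  then have "(\<lambda>n. inner (\<iota> g) (\<iota> (u n)) - (LINT s:{0..T}|lborel. g s * h s)) \<longlonglongrightarrow> 0"
    by (rule Lim_null_comparison[OF always_eventually[OF allI] tendsto_mult_left_zero[OF u(3)]])
  then have "(\<lambda>n. inner (\<iota> g) (\<iota> (u n))) \<longlonglongrightarrow> (LINT s:{0..T}|lborel. g s * h s)"
    by (simp add: LIM_zero_iff)
  moreover have "(\<lambda>n. inner (\<iota> g) (\<iota> (u n))) \<longlonglongrightarrow> inner (\<iota> g) f"
    by (intro tendsto_intros u)
  ultimately show ?thesis using LIMSEQ_unique by blast
qed

lemma is_Phi_lincomb:
  assumes "is_Phi H T \<iota> f1 g1" "is_Phi H T \<iota> f2 g2"
  shows "is_Phi H T \<iota> (a *\<^sub>R f1 + b *\<^sub>R f2) (\<lambda>t. a * g1 t + b * g2 t)"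
proof -
  obtain u where u: "\<And>n. u n \<in> L2_fun T" "(\<lambda>n. \<iota> (u n)) \<longlonglongrightarrow> f1"
    "(\<lambda>n. LINT t:{0..T}|lborel. \<bar>phi_integral H T (u n) t - g1 t\<bar>) \<longlonglongrightarrow> 0"
    and g1: "set_integrable lborel {0..T} g1"
    using assms(1) unfolding is_Phi_def by blast
  obtain v where v: "\<And>n. v n \<in> L2_fun T" "(\<lambda>n. \<iota> (v n)) \<longlonglongrightarrow> f2"
    "(\<lambda>n. LINT t:{0..T}|lborel. \<bar>phi_integral H T (v n) t - g2 t\<bar>) \<longlonglongrightarrow> 0"
    and g2: "set_integrable lborel {0..T} g2"
    using assms(2) unfolding is_Phi_def by blast
  let ?w = "\<lambda>n s. a * u n s + b * v n s" and ?g = "\<lambda>t. a * g1 t + b * g2 t"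
  have w: "?w n \<in> L2_fun T" for n by (intro L2_fun_lincomb u v)
  have g: "set_integrable lborel {0..T} ?g" using g1 g2 by simp
  have d1: "set_integrable lborel {0..T} (\<lambda>t. \<bar>phi_integral H T (u n) t - g1 t\<bar>)" for n
    by (intro set_integrable_abs set_integral_diff phi_integral_integrable u g1)
  have d2: "set_integrable lborel {0..T} (\<lambda>t. \<bar>phi_integral H T (v n) t - g2 t\<bar>)" for n
    by (intro set_integrable_abs set_integral_diff phi_integral_integrable v g2)
  have le: "norm (LINT t:{0..T}|lborel. \<bar>phi_integral H T (?w n) t - ?g t\<bar>) \<le>
      \<bar>a\<bar> * (LINT t:{0..T}|lborel. \<bar>phi_integral H T (u n) t - g1 t\<bar>) +
      \<bar>b\<bar> * (LINT t:{0..T}|lborel. \<bar>phi_integral H T (v n) t - g2 t\<bar>)" for n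
  proof -
    have "(LINT t:{0..T}|lborel. \<bar>phi_integral H T (?w n) t - ?g t\<bar>) \<le>
        (LINT t:{0..T}|lborel. \<bar>a\<bar> * \<bar>phi_integral H T (u n) t - g1 t\<bar> + \<bar>b\<bar> * \<bar>phi_integral H T (v n) t - g2 t\<bar>)"
    proof (rule set_integral_mono_AE)
      show "set_integrable lborel {0..T} (\<lambda>t. \<bar>phi_integral H T (?w n) t - ?g t\<bar>)"
        by (intro set_integrable_abs set_integral_diff phi_integral_integrable w g)
      show "set_integrable lborel {0..T}
          (\<lambda>t. \<bar>a\<bar> * \<bar>phi_integral H T (u n) t - g1 t\<bar> + \<bar>b\<bar> * \<bar>phi_integral H T (v n) t - g2 t\<bar>)"
        using d1 d2 by simp
      show "AE t\<in>{0..T} in lborel. \<bar>phi_integral H T (?w n) t - ?g t\<bar> \<le>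
          \<bar>a\<bar> * \<bar>phi_integral H T (u n) t - g1 t\<bar> + \<bar>b\<bar> * \<bar>phi_integral H T (v n) t - g2 t\<bar>"
        using phi_integral_lincomb[OF u(1)[of n] v(1)[of n], of a b]
      proof eventually_elim
        case (elim t)
        have "a * x + b * y - (a * x' + b * y') = a * (x - x') + b * (y - y')" for x y x' y' :: real
          by (simp add: algebra_simps)
        then show ?case using elim by (auto simp flip: abs_mult intro: abs_triangle_ineq)
      qed
    qed
    also have "\<dots> = \<bar>a\<bar> * (LINT t:{0..T}|lborel. \<bar>phi_integral H T (u n) t - g1 t\<bar>) +
      \<bar>b\<bar> * (LINT t:{0..T}|lborel. \<bar>phi_integral H T (v n) t - g2 t\<bar>)"
      using d1 d2 by (simp add: set_integral_add)
    moreover have "0 \<le> (LINT t:{0..T}|lborel. \<bar>phi_integral H T (?w n) t - ?g t\<bar>)"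
      by (simp add: set_lebesgue_integral_def)
    ultimately show ?thesis by simp
  qed
  have "(\<lambda>n. \<bar>a\<bar> * (LINT t:{0..T}|lborel. \<bar>phi_integral H T (u n) t - g1 t\<bar>) +
      \<bar>b\<bar> * (LINT t:{0..T}|lborel. \<bar>phi_integral H T (v n) t - g2 t\<bar>)) \<longlonglongrightarrow> 0"
    by (intro tendsto_add_zero tendsto_mult_right_zero u v)
  then have "(\<lambda>n. LINT t:{0..T}|lborel. \<bar>phi_integral H T (?w n) t - ?g t\<bar>) \<longlonglongrightarrow> 0"
    by (rule Lim_null_comparison[rotated]) (intro always_eventually allI le)
  moreover have "(\<lambda>n. \<iota> (?w n)) \<longlonglongrightarrow> a *\<^sub>R f1 + b *\<^sub>R f2"
    by (simp add: iota_lincomb u(1) v(1)) (intro tendsto_intros u v)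
  ultimately show ?thesis unfolding is_Phi_def using w g by (intro conjI exI[of _ ?w]) auto
qed

text \<open>\<open>Phi\<close> is a \<open>SOME\<close> choice and says something only where a
  version exists. The vectors that have one form a subspace, so it is enough to know them on a
  spanning set.\<close>

lemma is_Phi_Phi:
  assumes "f \<in> span B" "\<And>e. e \<in> B \<Longrightarrow> \<exists>g. is_Phi H T \<iota> e g"
  shows "is_Phi H T \<iota> f (Phi H T \<iota> f)"
proof -
  have z: "is_Phi H T \<iota> 0 (\<lambda>_. 0)"
    unfolding is_Phi_def
    by (auto intro!: exI[of _ "\<lambda>_ _. 0"] simp: L2_fun_zero iota_zero phi_integral_def set_lebesgue_integral_def set_integrable_def)
  have "subspace {f. \<exists>g. is_Phi H T \<iota> f g}"
  proof (rule subspaceI)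
    show "0 \<in> {f. \<exists>g. is_Phi H T \<iota> f g}" using z by blast
  next
    fix x y assume "x \<in> {f. \<exists>g. is_Phi H T \<iota> f g}" "y \<in> {f. \<exists>g. is_Phi H T \<iota> f g}"
    then obtain g h where "is_Phi H T \<iota> x g" "is_Phi H T \<iota> y h" by blast
    from is_Phi_lincomb[OF this, of 1 1] show "x + y \<in> {f. \<exists>g. is_Phi H T \<iota> f g}" by auto
  next
    fix c x assume "x \<in> {f. \<exists>g. is_Phi H T \<iota> f g}"
    then obtain g where "is_Phi H T \<iota> x g" by blast
    from is_Phi_lincomb[OF this z, of c 0] show "c *\<^sub>R x \<in> {f. \<exists>g. is_Phi H T \<iota> f g}" by auto
  qed
  then have "span B \<subseteq> {f. \<exists>g. is_Phi H T \<iota> f g}"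
    using assms(2) by (intro span_minimal) auto
  then have "\<exists>g. is_Phi H T \<iota> f g" using assms(1) by blast
  then show ?thesis unfolding Phi_def by (rule someI_ex)
qed

text \<open>The primitive does not see which version is chosen, so the shift path in
  \<open>translate\<close> is determined by the vector alone.\<close>

lemma integral_Phi:
  assumes "is_Phi H T \<iota> f g" "t \<in> {0..T}"
  shows "(LINT r:{0..t}|lborel. g r) = inner (\<iota> (indicator {0..t})) f"
proof -
  have "inner (\<iota> (indicator {0..t})) f = (LINT s:{0..T}|lborel. indicator {0..t} s * g s)"
    by (rule is_Phi_inner[OF assms(1), where B = 1]) (auto simp: set_borel_measurable_def indicator_def)
  also have "\<dots> = (LINT r:{0..t}|lborel. g r)"
    unfolding set_lebesgue_integral_def using assms(2)
    by (intro Bochner_Integration.integral_cong) (auto simp: indicator_def)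
  finally show ?thesis by simp
qed

end

section \<open>Translatable versions of the Wiener integral\<close>

lemma apply_path_of:
  assumes "T > 0" "continuous_on {0..T} f"
  shows "apply_bcontfun (path_of T f) t = f (max 0 (min T t))"
proof -
  have "continuous_on UNIV (\<lambda>t. f (max 0 (min T t)))"
    by (rule continuous_on_compose2[OF assms(2)]) (use assms(1) in \<open>auto intro!: continuous_intros\<close>)
  moreover have "bounded (range (\<lambda>t. f (max 0 (min T t))))"
  proof (rule bounded_subset)
    show "bounded (f ` {0..T})"
      using assms(2) by (intro compact_imp_bounded compact_continuous_image) auto
  qed (use assms(1) in auto)
  ultimately show ?thesis
    unfolding path_of_def by (subst Bcontfun_inverse) (auto simp: bcontfun_def)
qed

lemma continuous_on_LINT:
  fixes g :: "real \<Rightarrow> real"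
  assumes "set_integrable lborel {0..T} g"
  shows "continuous_on {0..T} (\<lambda>t. LINT r:{0..t}|lborel. g r)"
proof -
  have "g integrable_on {0..T}" by (rule set_borel_integral_eq_integral(1)[OF assms])
  then have "continuous_on {0..T} (\<lambda>t. integral {0..t} g)"
    by (rule indefinite_integral_continuous_1)
  moreover have "(LINT r:{0..t}|lborel. g r) = integral {0..t} g" if "t \<in> {0..T}" for t
    using that by (intro set_borel_integral_eq_integral(2) set_integrable_subset[OF assms]) auto
  ultimately show ?thesis
    using continuous_on_cong[OF refl, of "{0..T}" "\<lambda>t. LINT r:{0..t}|lborel. g r" "\<lambda>t. integral {0..t} g"]
    by simp
qed

text \<open>The series of squares has finite integral by monotone convergence, so it converges
  almost surely and its terms tend to 0.\<close>

lemma AE_tendsto_zero_if_summable_L2: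
  fixes Y :: "nat \<Rightarrow> 'a \<Rightarrow> real"
  assumes m: "\<And>n. Y n \<in> borel_measurable M" and i: "\<And>n. integrable M (\<lambda>\<omega>. (Y n \<omega>)\<^sup>2)"
    and s: "summable (\<lambda>n. \<integral>\<omega>. (Y n \<omega>)\<^sup>2 \<partial>M)"
  shows "AE \<omega> in M. (\<lambda>n. Y n \<omega>) \<longlonglongrightarrow> 0"
proof -
  note [measurable] = m
  have "(\<integral>\<^sup>+\<omega>. (\<Sum>n. ennreal ((Y n \<omega>)\<^sup>2)) \<partial>M) = (\<Sum>n. \<integral>\<^sup>+\<omega>. ennreal ((Y n \<omega>)\<^sup>2) \<partial>M)"
    by (rule nn_integral_suminf) measurable
  also have "\<dots> = (\<Sum>n. ennreal (\<integral>\<omega>. (Y n \<omega>)\<^sup>2 \<partial>M))"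
    by (intro suminf_cong nn_integral_eq_integral i) auto
  also have "\<dots> = ennreal (\<Sum>n. \<integral>\<omega>. (Y n \<omega>)\<^sup>2 \<partial>M)"
    by (intro suminf_ennreal2 s) auto
  finally have "(\<integral>\<^sup>+\<omega>. (\<Sum>n. ennreal ((Y n \<omega>)\<^sup>2)) \<partial>M) \<noteq> \<infinity>" by simp
  then have "AE \<omega> in M. (\<Sum>n. ennreal ((Y n \<omega>)\<^sup>2)) \<noteq> \<infinity>"
    by (intro nn_integral_PInf_AE) measurable
  then show ?thesis
  proof eventually_elim
    case (elim \<omega>)
    then have "summable (\<lambda>n. (Y n \<omega>)\<^sup>2)" by (intro summable_suminf_not_top) auto
    then have "(\<lambda>n. (Y n \<omega>)\<^sup>2) \<longlonglongrightarrow> 0" by (rule summable_LIMSEQ_zero)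
    then have "(\<lambda>n. sqrt ((Y n \<omega>)\<^sup>2)) \<longlonglongrightarrow> sqrt 0" by (rule tendsto_real_sqrt)
    then have "(\<lambda>n. \<bar>Y n \<omega>\<bar>) \<longlonglongrightarrow> 0" by simp
    then show ?case by (rule tendsto_rabs_zero_cancel)
  qed
qed

lemma integrable_exp_centered_gaussian:
  assumes "prob_space M" "centered_gaussian M X"
  shows "integrable M (\<lambda>\<omega>. exp (a * \<bar>X \<omega>\<bar>))"
proof -
  interpret prob_space M by fact
  have X [measurable]: "X \<in> borel_measurable M" using assms(2) by (simp add: centered_gaussian_def)
  consider s where "s > 0" "distributed M lborel X (\<lambda>x. ennreal (normal_density 0 s x))"
    | "AE \<omega> in M. X \<omega> = 0"
    using assms(2) by (auto simp: centered_gaussian_def)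
  then show ?thesis
  proof cases
    case 1
    \<comment> \<open>Completing the square: the exponential factor moves the mean of the density to
      c s^2, up to a constant.\<close>
    have shift: "normal_density 0 s x * exp (c * x) = exp (c\<^sup>2 * s\<^sup>2 / 2) * normal_density (c * s\<^sup>2) s x" for c x
    proof -
      have "- (x - 0)\<^sup>2 / (2 * s\<^sup>2) + c * x = c\<^sup>2 * s\<^sup>2 / 2 + - (x - c * s\<^sup>2)\<^sup>2 / (2 * s\<^sup>2)"
        using 1(1) by (simp add: field_simps power2_eq_square)
      then have "exp (- (x - 0)\<^sup>2 / (2 * s\<^sup>2)) * exp (c * x) = exp (c\<^sup>2 * s\<^sup>2 / 2) * exp (- (x - c * s\<^sup>2)\<^sup>2 / (2 * s\<^sup>2))"
        by (simp only: exp_add[symmetric])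
      then show ?thesis by (simp add: normal_density_def)
    qed
    have "integrable lborel (\<lambda>x. normal_density 0 s x * exp (c * x))" for c
      unfolding shift using 1(1) by (intro integrable_mult_right integrable_normal_density)
    then have i: "integrable lborel (\<lambda>x. normal_density 0 s x * exp (a * x) + normal_density 0 s x * exp (- a * x))"
      by (intro Bochner_Integration.integrable_add)
    have "integrable lborel (\<lambda>x. normal_density 0 s x * exp (a * \<bar>x\<bar>))"
    proof (rule Bochner_Integration.integrable_bound[OF i])
      have "exp (a * \<bar>x\<bar>) \<le> exp (a * x) + exp (- a * x)" for x
        by (cases "x \<ge> 0") (auto simp: add_increasing add_increasing2)
      then have "normal_density 0 s x * exp (a * \<bar>x\<bar>) \<le> normal_density 0 s x * (exp (a * x) + exp (- a * x))" for x
        by (intro mult_left_mono) auto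
      then show "AE x in lborel. norm (normal_density 0 s x * exp (a * \<bar>x\<bar>)) \<le>
          norm (normal_density 0 s x * exp (a * x) + normal_density 0 s x * exp (- a * x))"
        by (simp add: distrib_left)
    qed measurable
    then show ?thesis
      using distributed_integrable[OF 1(2), of "\<lambda>x. exp (a * \<bar>x\<bar>)"] by simp
  next
    case 2
    then have "AE \<omega> in M. 1 = exp (a * \<bar>X \<omega>\<bar>)" by eventually_elim simp
    moreover have "integrable M (\<lambda>_. 1 :: real)" by simp
    ultimately show ?thesis
      using integrable_cong_AE[of "\<lambda>_. 1 :: real" M "\<lambda>\<omega>. exp (a * \<bar>X \<omega>\<bar>)"] by simp
  qed
qed

text \<open>Avoids independence of the summands: the exponential of a sum is dominated by
  the exponential of the largest summand times their number.\<close>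

lemma exp_sum_le:
  fixes y :: "'a \<Rightarrow> real"
  assumes "finite J" "J \<noteq> {}"
  shows "exp (\<Sum>j\<in>J. y j) \<le> (\<Sum>j\<in>J. exp (card J * y j))"
proof -
  have "Max (y ` J) \<in> y ` J" using assms by (intro Max_in) auto
  then obtain m where "m \<in> J" "y m = Max (y ` J)" by (metis imageE)
  then have m: "m \<in> J" "\<And>j. j \<in> J \<Longrightarrow> y j \<le> y m"
    using Max_ge[of "y ` J"] assms by auto
  have "(\<Sum>j\<in>J. y j) \<le> card J * y m"
    using sum_mono[of J y "\<lambda>_. y m"] m by simp
  then have "exp (\<Sum>j\<in>J. y j) \<le> exp (card J * y m)" by simp
  also have "\<dots> \<le> (\<Sum>j\<in>J. exp (card J * y j))"
    by (rule member_le_sum) (use m assms in auto)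
  finally show ?thesis .
qed

section \<open>Projection onto the span of a finite orthonormal system\<close>

lemma orth_proj_orthonormal:
  fixes e :: "nat \<Rightarrow> 'h::real_inner"
  assumes on: "\<And>j k. j \<in> J \<Longrightarrow> k \<in> J \<Longrightarrow> inner (e j) (e k) = (if j = k then 1 else 0)" and J: "finite J"
  shows "orth_proj (span (e ` J)) x = (\<Sum>k\<in>J. inner x (e k) *\<^sub>R e k)"
proof -
  let ?p = "\<Sum>k\<in>J. inner x (e k) *\<^sub>R e k"
  have p: "?p \<in> span (e ` J)" by (intro span_sum span_scale span_base) auto
  have "inner (x - ?p) (e j) = 0" if "j \<in> J" for j
    using that J by (simp add: inner_diff_left inner_sum_left on if_distrib[of "\<lambda>r. _ * r"] sum.delta cong: if_cong)
  then have "span (e ` J) \<subseteq> {z. inner (x - ?p) z = 0}"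
    by (intro span_minimal subspace_hyperplane) auto
  then have orth: "inner (x - ?p) z = 0" if "z \<in> span (e ` J)" for z using that by blast
  show ?thesis unfolding orth_proj_def
  proof (rule the_equality)
    fix y assume y: "y \<in> span (e ` J) \<and> (\<forall>z\<in>span (e ` J). inner (x - y) z = 0)"
    then have d: "y - ?p \<in> span (e ` J)" using p by (intro span_diff) auto
    \<comment> \<open>The difference of two candidates lies in the span and is orthogonal to it,
      hence to itself.\<close>
    have "inner (y - ?p) (y - ?p) = inner (x - ?p) (y - ?p) - inner (x - y) (y - ?p)"
      by (simp flip: inner_diff_left)
    also have "\<dots> = 0" using y d orth by simp
    finally show "y = ?p" by simp
  qed (use p orth in blast)
qed

lemma orthonormal_expansion:
  fixes e :: "nat \<Rightarrow> 'h::real_inner"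
  assumes on: "\<And>j k. j \<in> J \<Longrightarrow> k \<in> J \<Longrightarrow> inner (e j) (e k) = (if j = k then 1 else 0)" and J: "finite J"
    and f: "f \<in> span (e ` J)"
  shows "(\<Sum>k\<in>J. inner (e k) f *\<^sub>R e k) = f"
  using f
proof (induction rule: span_induct_alt)
  case (step c x y)
  then obtain j where j: "j \<in> J" "x = e j" by auto
  have "(\<Sum>k\<in>J. inner (e k) x *\<^sub>R e k) = (\<Sum>k\<in>J. if k = j then e k else 0)"
    by (rule sum.cong) (auto simp: on j)
  also have "\<dots> = x" using j J by simp
  finally show ?case
    using step(2) by (simp add: inner_add_right scaleR_add_left sum.distrib flip: scaleR_scaleR scaleR_sum_right)
qed simp

section \<open>Wiener integrals as functionals of the path\<close>

locale fbm_integral = phi_hilbert T H \<iota> for T H :: real and \<iota> :: "(real \<Rightarrow> real) \<Rightarrow> 'h::{real_inner,complete_space}" +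
  fixes P :: "'d::finite path measure" and W :: "'d \<Rightarrow> 'h \<Rightarrow> 'd path \<Rightarrow> real"
  assumes fbm: "fbm_measure H T P" and wiener: "wiener_integral T P \<iota> W"
begin

abbreviation clip :: "real \<Rightarrow> real" where "clip t \<equiv> max 0 (min T t)"

lemma prob_space_P: "prob_space P"
  using fbm by (simp add: fbm_measure_def)

lemma linear_W: "\<omega> \<in> space P \<Longrightarrow> linear (\<lambda>f. W i f \<omega>)"
  and gaussian_W: "centered_gaussian P (W i f)"
  and W_indicator: "t \<in> {0..T} \<Longrightarrow> AE \<omega> in P. W i (\<iota> (indicator {0..t})) \<omega> = apply_bcontfun \<omega> t $ i"
  and W_isometry: "(\<integral>\<omega>. (W i f \<omega>)\<^sup>2 \<partial>P) = (norm f)\<^sup>2"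
  using wiener unfolding wiener_integral_def by blast+

lemma measurable_W: "W i f \<in> borel_measurable P"
  using gaussian_W by (simp add: centered_gaussian_def)

text \<open>The isometry only gives the value of an integral. A nonzero value already forces
  integrability, because a non-integrable function would have integral 0; for f = 0 the variable
  vanishes by linearity.\<close>

lemma integrable_W_sq: "integrable P (\<lambda>\<omega>. (W i f \<omega>)\<^sup>2)"
proof (cases "f = 0")
  case True
  then have "W i f \<omega> = 0" if "\<omega> \<in> space P" for \<omega>
    using linear_0[OF linear_W[OF that]] by simp
  then show ?thesis by (subst Bochner_Integration.integrable_cong[where g = "\<lambda>_. 0"]) auto
next
  case False
  then have "(\<integral>\<omega>. (W i f \<omega>)\<^sup>2 \<partial>P) \<noteq> 0" by (simp add: W_isometry)
  then show ?thesis using not_integrable_integral_eq by blast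
qed

lemma measurable_coordinate:
  assumes "t \<in> {0..T}"
  shows "(\<lambda>\<omega>. apply_bcontfun \<omega> t $ i) \<in> borel_measurable P"
proof -
  have "centered_gaussian P (\<lambda>\<omega>. \<Sum>s\<in>{t}. 1 * (apply_bcontfun \<omega> s $ i))"
    using fbm assms unfolding fbm_measure_def centered_gaussian_process_def
    by (elim conjE allE[of _ i] allE[of _ "{t}"] allE[of _ "\<lambda>_. 1"]) auto
  then show ?thesis by (simp add: centered_gaussian_def)
qed

text \<open>The last clause evaluates the functional at the Cameron--Martin path of \<open>f\<close>.\<close>

definition path_functional :: "'h \<Rightarrow> ((real \<Rightarrow> real) \<Rightarrow> real) \<Rightarrow> bool" where
  "path_functional v l \<longleftrightarrow> (\<forall>x y. l (\<lambda>t. x t - y t) = l x - l y) \<and>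
    (\<forall>i. (\<lambda>\<omega>. l (\<lambda>t. apply_bcontfun \<omega> t $ i)) \<in> borel_measurable P) \<and>
    (\<forall>i. AE \<omega> in P. W i v \<omega> = l (\<lambda>t. apply_bcontfun \<omega> t $ i)) \<and>
    (\<forall>f. l (\<lambda>t. inner (\<iota> (indicator {0..clip t})) f) = inner v f)"

text \<open>Evaluation at \<open>t0\<close> represents the indicator of [0, t0], and linear
  combinations follow. The functional acts on scalar functions, so that one \<open>l\<close> serves
  every component and the shift paths as well.\<close>

lemma path_functional_exists:
  assumes "v \<in> span ((\<lambda>t. \<iota> (indicator {0..t})) ` {0..T})"
  shows "\<exists>l. path_functional v l"
proof -
  show ?thesis
    using assms unfolding path_functional_def
  proof (induction rule: span_induct_alt)
    case base
    have "AE \<omega> in P. W i 0 \<omega> = 0" for i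
      by (rule AE_I2) (rule linear_0[OF linear_W])
    then show ?case by (intro exI[of _ "\<lambda>_. 0"]) auto
  next
    case (step c x v)
    obtain t0 where t0: "t0 \<in> {0..T}" "x = \<iota> (indicator {0..t0})" using step(1) by auto
    obtain l where l: "\<And>x y. l (\<lambda>t. x t - y t) = l x - l y"
      "\<And>i. (\<lambda>\<omega>. l (\<lambda>t. apply_bcontfun \<omega> t $ i)) \<in> borel_measurable P"
      "\<And>i. AE \<omega> in P. W i v \<omega> = l (\<lambda>t. apply_bcontfun \<omega> t $ i)"
      "\<And>f. l (\<lambda>t. inner (\<iota> (indicator {0..clip t})) f) = inner v f"
      using step(2) by auto
    note [measurable] = l(2) measurable_coordinate[OF t0(1)]
    have "AE \<omega> in P. W i (c *\<^sub>R x + v) \<omega> = c * (apply_bcontfun \<omega> t0 $ i) + l (\<lambda>t. apply_bcontfun \<omega> t $ i)" for i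
      using l(3)[of i] W_indicator[OF t0(1), of i] AE_space
    proof eventually_elim
      case (elim \<omega>)
      have "W i (c *\<^sub>R x + v) \<omega> = c *\<^sub>R W i x \<omega> + W i v \<omega>"
        using linear_add[OF linear_W[OF elim(3), of i], of "c *\<^sub>R x" v]
          linear_scale[OF linear_W[OF elim(3), of i], of c x] by simp
      then show ?case using elim t0 by simp
    qed
    moreover have "clip t0 = t0" using t0 by auto
    ultimately show ?case
      by (intro exI[of _ "\<lambda>x. c * x t0 + l x"])
         (auto simp: l(1,4) t0(2) algebra_simps inner_add_left)
  qed
qed

abbreviation cm_shift :: "'d \<Rightarrow> 'h \<Rightarrow> 'd path" where
  "cm_shift j g \<equiv> path_of T (\<lambda>t. (LINT r:{0..t}|lborel. Phi H T \<iota> g r) *\<^sub>R axis j 1)"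

lemma apply_cm_shift:
  assumes "is_Phi H T \<iota> g (Phi H T \<iota> g)"
  shows "apply_bcontfun (cm_shift j g) t $ i =
    (if i = j then inner (\<iota> (indicator {0..clip t})) g else 0)"
proof -
  have "set_integrable lborel {0..T} (Phi H T \<iota> g)" using assms by (simp add: is_Phi_def)
  then have "continuous_on {0..T} (\<lambda>t. (LINT r:{0..t}|lborel. Phi H T \<iota> g r) *\<^sub>R (axis j 1 :: real ^ 'd))"
    by (intro continuous_intros continuous_on_LINT)
  from apply_path_of[OF T this]
  have "apply_bcontfun (cm_shift j g) t = (LINT r:{0..clip t}|lborel. Phi H T \<iota> g r) *\<^sub>R axis j 1" .
  moreover have "(LINT r:{0..clip t}|lborel. Phi H T \<iota> g r) = inner (\<iota> (indicator {0..clip t})) g"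
    using T by (intro integral_Phi assms) auto
  ultimately show ?thesis by (simp add: axis_def)
qed

text \<open>The null set is fixed before \<open>j\<close> and \<open>g\<close>, since in the Wick
  integral the shift varies with s and t along one path. An almost sure identity for
  \<open>W i f\<close> would say nothing about the shifts of a given path.\<close>

definition translatable_version :: "'h \<Rightarrow> ('d \<Rightarrow> 'd path \<Rightarrow> real) \<Rightarrow> bool" where
  "translatable_version f Z \<longleftrightarrow>
    (\<forall>i. Z i \<in> borel_measurable P \<and> (AE \<omega> in P. Z i \<omega> = W i f \<omega>) \<and>
      (AE \<omega> in P. \<forall>j g. is_Phi H T \<iota> g (Phi H T \<iota> g) \<longrightarrow>
         Z i (\<omega> - cm_shift j g) = Z i \<omega> - (if i = j then inner f g else 0)))"

text \<open>On the linear space of paths along which the approximating functionals converge, the limit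
  is additive without exceptional sets, and all the shifts belong to that space. Hence one null set
  serves the uncountably many shifts at once.\<close>

lemma translatable_version_exists: "\<exists>Z. translatable_version f Z"
proof -
  have "f \<in> closure (span ((\<lambda>t. \<iota> (indicator {0..t})) ` {0..T}))"
    using steps_UNIV by (auto simp: steps_def)
  \<comment> \<open>This rate makes the squared L2 errors summable, at most (1/4)^n, and so gives
    almost sure convergence of the whole sequence.\<close>
  then have "\<exists>v\<in>span ((\<lambda>t. \<iota> (indicator {0..t})) ` {0..T}). dist v f < (1/2) ^ n" for n :: nat
    using closure_approachable by (metis zero_less_power half_gt_zero zero_less_one)
  then obtain v where v: "\<And>n. v n \<in> span ((\<lambda>t. \<iota> (indicator {0..t})) ` {0..T})"
    and vd: "\<And>n::nat. dist (v n) f < (1/2) ^ n" by metis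
  have vlim: "v \<longlonglongrightarrow> f"
  proof -
    have "(\<lambda>n. (1/2::real) ^ n) \<longlonglongrightarrow> 0" by (rule LIMSEQ_power_zero) simp
    then have "(\<lambda>n. dist (v n) f) \<longlonglongrightarrow> 0"
      by (rule Lim_null_comparison[rotated]) (use vd in \<open>auto intro!: always_eventually intro: less_imp_le\<close>)
    then show ?thesis by (subst tendsto_dist_iff)
  qed
  obtain l where "\<And>n. path_functional (v n) (l n)"
    using path_functional_exists[OF v] by metis
  then have ldiff: "\<And>n x y. l n (\<lambda>t. x t - y t) = l n x - l n y"
    and lmeas: "\<And>n i. (\<lambda>\<omega>. l n (\<lambda>t. apply_bcontfun \<omega> t $ i)) \<in> borel_measurable P"
    and lW: "\<And>n i. AE \<omega> in P. W i (v n) \<omega> = l n (\<lambda>t. apply_bcontfun \<omega> t $ i)"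
    and lPhi: "\<And>n f. l n (\<lambda>t. inner (\<iota> (indicator {0..clip t})) f) = inner (v n) f"
    unfolding path_functional_def by simp_all
  have l0: "l n (\<lambda>t. 0) = 0" for n using ldiff[of n "\<lambda>_. 0" "\<lambda>_. 0"] by simp
  \<comment> \<open>A formula valid on every path, so that it can be evaluated at shifted
    paths.\<close>
  define Z where "Z i \<omega> = lim (\<lambda>n. l n (\<lambda>t. apply_bcontfun \<omega> t $ i))" for i :: 'd and \<omega>
  have conv: "AE \<omega> in P. (\<lambda>n. l n (\<lambda>t. apply_bcontfun \<omega> t $ i)) \<longlonglongrightarrow> W i f \<omega>" for i
  proof -
    have "AE \<omega> in P. (\<lambda>n. W i (v n - f) \<omega>) \<longlonglongrightarrow> 0"
    proof (rule AE_tendsto_zero_if_summable_L2)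
      have "norm (\<integral>\<omega>. (W i (v n - f) \<omega>)\<^sup>2 \<partial>P) \<le> (1/4) ^ n" for n
      proof -
        have "(norm (v n - f))\<^sup>2 \<le> ((1/2) ^ n)\<^sup>2"
          using vd[of n] by (intro power_mono) (auto simp: dist_norm)
        also have "((1/2::real) ^ n)\<^sup>2 = (1/4) ^ n" by (simp add: power2_eq_square flip: power_mult_distrib)
        finally show ?thesis by (simp add: W_isometry)
      qed
      then show "summable (\<lambda>n. \<integral>\<omega>. (W i (v n - f) \<omega>)\<^sup>2 \<partial>P)"
        by (rule summable_comparison_test'[OF summable_geometric[of "1/4 :: real"], rotated]) auto
    qed (rule measurable_W integrable_W_sq)+
    moreover have "AE \<omega> in P. \<forall>n. W i (v n) \<omega> = l n (\<lambda>t. apply_bcontfun \<omega> t $ i)"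
      using lW by (simp add: AE_all_countable)
    ultimately show ?thesis using AE_space
    proof eventually_elim
      case (elim \<omega>)
      have "W i (v n - f) \<omega> = W i (v n) \<omega> - W i f \<omega>" for n
        using linear_diff[OF linear_W[OF elim(3), of i]] by simp
      with elim(1) have "(\<lambda>n. W i (v n) \<omega> - W i f \<omega>) \<longlonglongrightarrow> 0" by simp
      then have "(\<lambda>n. W i (v n) \<omega>) \<longlonglongrightarrow> W i f \<omega>" by (rule LIM_zero_cancel)
      then show ?case using elim(2) by simp
    qed
  qed
  show ?thesis
    unfolding translatable_version_def
  proof (intro exI[of _ Z] allI conjI)
    show "Z i \<in> borel_measurable P" for i
      unfolding Z_def[abs_def] by (intro borel_measurable_lim_metric lmeas)
    show "AE \<omega> in P. Z i \<omega> = W i f \<omega>" for i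
      using conv[of i] by eventually_elim (simp add: Z_def limI)
    show "AE \<omega> in P. \<forall>j g. is_Phi H T \<iota> g (Phi H T \<iota> g) \<longrightarrow>
       Z i (\<omega> - cm_shift j g) = Z i \<omega> - (if i = j then inner f g else 0)" for i
      using conv[of i]
    proof eventually_elim
      case (elim \<omega>)
      show ?case
      proof (intro allI impI)
        fix j g assume g: "is_Phi H T \<iota> g (Phi H T \<iota> g)"
        have "l n (\<lambda>t. apply_bcontfun (\<omega> - cm_shift j g) t $ i) =
            l n (\<lambda>t. apply_bcontfun \<omega> t $ i) - (if i = j then inner (v n) g else 0)" for n
          by (simp add: apply_cm_shift[OF g] ldiff lPhi l0)
        moreover have "(\<lambda>n. l n (\<lambda>t. apply_bcontfun \<omega> t $ i) - (if i = j then inner (v n) g else 0))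
            \<longlonglongrightarrow> W i f \<omega> - (if i = j then inner f g else 0)"
          using elim vlim by (auto intro!: tendsto_intros)
        ultimately have "Z i (\<omega> - cm_shift j g) = W i f \<omega> - (if i = j then inner f g else 0)"
          unfolding Z_def by (simp add: limI)
        moreover have "Z i \<omega> = W i f \<omega>" using elim by (simp add: Z_def limI)
        ultimately show "Z i (\<omega> - cm_shift j g) = Z i \<omega> - (if i = j then inner f g else 0)" by simp
      qed
    qed
  qed
qed

end

section \<open>Existence of a mild solution\<close>

theorem theorem1p2:
  fixes T H :: real
    and K :: nat
    and c :: "real ^ 'd::finite"
    and b :: "real \<Rightarrow> real ^ 'd \<Rightarrow> real ^ 'd"
    and \<sigma> :: "real \<Rightarrow> real ^ 'd"
    and P :: "'d path measure"
    and \<iota> :: "(real \<Rightarrow> real) \<Rightarrow> 'h::{real_inner,complete_space}"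
    and W :: "'d \<Rightarrow> 'h \<Rightarrow> 'd path \<Rightarrow> real"
    and e :: "nat \<Rightarrow> 'h"
    and \<xi> :: "nat \<Rightarrow> real \<Rightarrow> real"
  assumes "T > 0" and "1 / 2 < H" and "H < 1" and "K \<ge> 1"
    and "fbm_measure H T P"
    and "phi_completion H T \<iota>"
    and "wiener_integral T P \<iota> W"
    and "complete_orthonormal e"
    and "\<And>k. k \<ge> 1 \<Longrightarrow> is_Phi H T \<iota> (e k) (\<xi> k)"
    and "\<And>k. k \<ge> 1 \<Longrightarrow> continuous_on {0..T} (\<xi> k)"
    and "bounded ((\<lambda>(t, x). b t x) ` ({0..T} \<times> UNIV))"
    and "continuous_on ({0..T} \<times> UNIV) (\<lambda>(t, x). b t x)"
    and "\<And>j t x. t \<in> {0..T} \<Longrightarrow> (\<lambda>h. b t (x + h *\<^sub>R axis j 1)) differentiable (at 0)"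
    and "\<And>j. bounded ((\<lambda>(t, x). partial_deriv j (b t) x) ` ({0..T} \<times> UNIV))"
    and "\<And>j. continuous_on ({0..T} \<times> UNIV) (\<lambda>(t, x). partial_deriv j (b t) x)"
    and "bounded (\<sigma> ` {0..T})"
    and "continuous_on {0..T} \<sigma>"
  shows "\<exists>X. mild_solution H T P \<iota> W e K b \<sigma> c X"
proof -
  interpret fbm_integral T H \<iota> P W
    by unfold_locales (use assms in auto)
  let ?J = "{1..K}" and ?S = "span (e ` {1..K})"
  note Phi_e = assms(9) and \<xi>cont = assms(10) and \<sigma>cont = assms(17)
  have on: "inner (e j) (e k) = (if j = k then 1 else 0)" if "j \<in> ?J" "k \<in> ?J" for j k
    using assms(8) that by (auto simp: complete_orthonormal_def)
  obtain B where B: "\<And>t x. t \<in> {0..T} \<Longrightarrow> norm (b t x) \<le> B"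
    using assms(11) by (force simp: bounded_iff)
  have "\<exists>L. \<forall>t\<in>{0..T}. \<forall>x. norm (partial_deriv j (b t) x) \<le> L" for j
    using assms(14)[of j] by (force simp: bounded_iff)
  then obtain L where L: "\<And>j t x. t \<in> {0..T} \<Longrightarrow> norm (partial_deriv j (b t) x) \<le> L j" by metis
  \<comment> \<open>One bound for all directions at once: the sum dominates each
    \<open>L j\<close>.\<close>
  define Lip where "Lip = real CARD('d) * (\<Sum>j\<in>UNIV. \<bar>L j\<bar>)"
  have lip: "norm (b t x - b t y) \<le> Lip * norm (x - y)" if t: "t \<in> {0..T}" for t x y
    unfolding Lip_def
  proof (rule partial_derivs_imp_lipschitz)
    show "(\<lambda>h. b t (x + h *\<^sub>R axis j 1)) differentiable at 0" for j x using assms(13) t by blast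
    have "\<bar>L j\<bar> \<le> (\<Sum>j\<in>UNIV. \<bar>L j\<bar>)" for j by (rule member_le_sum) auto
    then show "norm (partial_deriv j (b t) x) \<le> (\<Sum>j\<in>UNIV. \<bar>L j\<bar>)" for j x
      using L[OF t, of j x] by (meson abs_ge_self order_trans)
  qed
  \<comment> \<open>By \<open>is_Phi_inner\<close> with the version \<open>\<xi> k\<close>, pairing
    the cut-off of \<sigma> to [s, t] with \<open>e k\<close> gives the integral of
    \<open>h i k\<close> over [s, t]. Thus \<open>h i k\<close> is the density of coefficient
    \<open>k\<close> of the projection.\<close>
  define h where "h i k r = \<sigma> r $ i * \<xi> k r" for i k r
  have hcont: "continuous_on {0..T} (h i k)" if "k \<in> ?J" for i k
    unfolding h_def using that \<xi>cont \<sigma>cont by (intro continuous_intros) auto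
  have hcont': "continuous_on {s..t} (h i k)" if "k \<in> ?J" "0 \<le> s" "t \<le> T" for i k s t
    by (rule continuous_on_subset[OF hcont[OF that(1)]]) (use that in auto)
  have hdiff: "integral {0..t} (h i k) - integral {0..s} (h i k) = integral {s..t} (h i k)"
    if "k \<in> ?J" "0 \<le> s" "s \<le> t" "t \<le> T" for i k s t
    using Henstock_Kurzweil_Integration.integral_combine[OF that(2,3) integrable_continuous_real[OF hcont'[OF that(1) order_refl that(4)]], of i]
    by simp
  define \<Gamma> where "\<Gamma> i t = (\<Sum>k\<in>?J. integral {0..t} (h i k) *\<^sub>R e k)" for i t
  have \<Gamma>diff: "\<Gamma> i t - \<Gamma> i s = (\<Sum>k\<in>?J. integral {s..t} (h i k) *\<^sub>R e k)"
    if "0 \<le> s" "s \<le> t" "t \<le> T" for i s t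
    using hdiff[OF _ that, of _ i] by (simp add: \<Gamma>_def flip: sum_subtractf scaleR_diff_left)
  have "bounded (\<Union>i\<in>UNIV. \<Union>k\<in>?J. h i k ` {0..T})"
    by (intro bounded_UN ballI finite compact_imp_bounded compact_continuous_image hcont) auto
  then obtain M where M: "\<And>i k r. k \<in> ?J \<Longrightarrow> r \<in> {0..T} \<Longrightarrow> \<bar>h i k r\<bar> \<le> M"
    by (force simp: bounded_iff)
  \<comment> \<open>There are \<open>K\<close> summands, and the \<open>e k\<close> are unit
    vectors.\<close>
  have \<Gamma>lip: "norm (\<Gamma> i t - \<Gamma> i s) \<le> real K * M * (t - s)" if st: "0 \<le> s" "s \<le> t" "t \<le> T" for i s t
  proof -
    have "norm (integral {s..t} (h i k) *\<^sub>R e k) \<le> M * (t - s)" if k: "k \<in> ?J" for k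
    proof -
      have "norm (integral {s..t} (h i k)) \<le> M * (t - s)"
        using st by (intro integral_bound hcont' k) (auto intro!: M k[simplified])
      moreover have "norm (e k) = 1" using on[OF k k] by (simp add: norm_eq_1)
      ultimately show ?thesis by simp
    qed
    then have "(\<Sum>k\<in>?J. norm (integral {s..t} (h i k) *\<^sub>R e k)) \<le> (\<Sum>k\<in>?J. M * (t - s))"
      by (rule sum_mono)
    then show ?thesis
      using norm_sum[of "\<lambda>k. integral {s..t} (h i k) *\<^sub>R e k" ?J] by (simp add: \<Gamma>diff[OF st] mult.assoc)
  qed
  have sigma_proj: "sigma_proj \<iota> e K \<sigma> i s t = \<Gamma> i t - \<Gamma> i s" if st: "0 \<le> s" "s \<le> t" "t \<le> T" for i s t
  proof -
    let ?g = "\<lambda>r. indicator {s..t} r * \<sigma> r $ i"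
    obtain N where N: "\<And>r. r \<in> {0..T} \<Longrightarrow> norm (\<sigma> r) \<le> N"
      using assms(16) by (force simp: bounded_iff)
    have "(\<lambda>r. indicator {0..T} r *\<^sub>R (\<sigma> r $ i)) \<in> borel_measurable borel"
      using \<sigma>cont by (intro borel_measurable_continuous_on_indicator continuous_intros) auto
    then have "(\<lambda>r. indicator {s..t} r * (indicator {0..T} r *\<^sub>R (\<sigma> r $ i))) \<in> borel_measurable lborel"
      by measurable
    then have g: "set_borel_measurable lborel {0..T} ?g"
      unfolding set_borel_measurable_def by (simp add: mult.left_commute)
    have "\<bar>?g r\<bar> \<le> N" if "r \<in> {0..T}" for r
      using N[OF that] component_le_norm_cart[of "\<sigma> r" i] by (auto simp: indicator_def)
    then have "inner (\<iota> ?g) (e k) = integral {s..t} (h i k)" if k: "k \<in> ?J" for k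
    proof -
      have "inner (\<iota> ?g) (e k) = (LINT r:{0..T}|lborel. ?g r * \<xi> k r)"
        using k \<open>\<And>r. r \<in> {0..T} \<Longrightarrow> \<bar>?g r\<bar> \<le> N\<close> by (intro is_Phi_inner[OF Phi_e g]) auto
      also have "\<dots> = (LINT r:{s..t}|lborel. h i k r)"
        unfolding set_lebesgue_integral_def using st
        by (intro Bochner_Integration.integral_cong) (auto simp: indicator_def h_def)
      also have "\<dots> = integral {s..t} (h i k)"
        by (intro set_borel_integral_eq_integral(2) borel_integrable_atLeastAtMost' hcont' k st)
      finally show ?thesis .
    qed
    then have "(\<Sum>k\<in>?J. inner (\<iota> ?g) (e k) *\<^sub>R e k) = \<Gamma> i t - \<Gamma> i s"
      unfolding \<Gamma>diff[OF st] by (intro sum.cong) auto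
    moreover have "orth_proj ?S (\<iota> ?g) = (\<Sum>k\<in>?J. inner (\<iota> ?g) (e k) *\<^sub>R e k)"
      by (rule orth_proj_orthonormal[OF on]) auto
    ultimately show ?thesis unfolding sigma_proj_def by simp
  qed
  have \<Gamma>0: "\<Gamma> i 0 = 0" for i by (simp add: \<Gamma>_def)
  have \<Gamma>_span: "\<Gamma> i t \<in> ?S" for i t
    unfolding \<Gamma>_def by (intro span_sum span_scale span_base) auto
  obtain F C A where F: "continuous_on UNIV (F :: real \<times> ('h ^ 'd) \<Rightarrow> real ^ 'd)"
    "\<And>t z. t \<in> {0..T} \<Longrightarrow> norm (F (t, z)) \<le> C * exp (A * norm z)"
    "\<And>t z i. t \<in> {0..T} \<Longrightarrow> set_integrable lborel {0..t} (\<lambda>s. b s (F (s, z - axis i (\<Gamma> i t - \<Gamma> i s))) $ i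
            * wexp (z $ i) (\<Gamma> i t - \<Gamma> i s))"
    "\<And>t z i. t \<in> {0..T} \<Longrightarrow> F (t, z) $ i = c $ i * wexp (z $ i) (\<Gamma> i t) +
        (LINT s:{0..t}|lborel. b s (F (s, z - axis i (\<Gamma> i t - \<Gamma> i s))) $ i * wexp (z $ i) (\<Gamma> i t - \<Gamma> i s))"
    by (rule wick_integral_equation[where c = c and \<Gamma> = \<Gamma>, OF assms(1,12)])
       (rule B lip \<Gamma>0 \<Gamma>lip that; assumption)+
  have C0: "C \<ge> 0"
    using F(2)[of 0 0] assms(1) by (auto intro: order_trans[OF norm_ge_zero])
  obtain Z where Z: "\<And>f. translatable_version f (Z f)" using translatable_version_exists by metis
  then have Zmeas: "\<And>f i. Z f i \<in> borel_measurable P"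
    and ZW: "\<And>f i. AE \<omega> in P. Z f i \<omega> = W i f \<omega>"
    and Zshift: "\<And>f i. AE \<omega> in P. \<forall>j g. is_Phi H T \<iota> g (Phi H T \<iota> g) \<longrightarrow>
         Z f i (\<omega> - cm_shift j g) = Z f i \<omega> - (if i = j then inner f g else 0)"
    unfolding translatable_version_def by blast+
  \<comment> \<open>Measurability is arranged through the coefficients: they form a function on a
    countable index type, where coordinatewise measurability suffices, and \<open>F\<close> composed
    with \<open>N\<close> is continuous in them.\<close>
  define N :: "(nat \<times> 'd \<Rightarrow> real) \<Rightarrow> 'h ^ 'd" where "N a = (\<chi> i. \<Sum>k\<in>?J. a (k, i) *\<^sub>R e k)" for a
  define Y where "Y \<omega> = N (\<lambda>p. Z (e (fst p)) (snd p) \<omega>)" for \<omega>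
  define X where "X t \<omega> = F (t, Y \<omega>)" for t \<omega>
  have Fcont: "continuous_on S (\<lambda>x. F (g x))" if "continuous_on S g"
    for S and g :: "'x::topological_space \<Rightarrow> real \<times> ('h ^ 'd)"
    by (rule continuous_on_compose2[OF F(1) that]) auto
  have Xmeas: "X t \<in> borel_measurable P" for t
  proof -
    have "continuous_on UNIV (\<lambda>a. F (t, N a))"
      unfolding N_def by (intro Fcont continuous_intros continuous_on_vec_lambda continuous_on_product_coordinates)
    then have "(\<lambda>a. F (t, N a)) \<in> borel_measurable borel" by (rule borel_measurable_continuous_onI)
    moreover have "(\<lambda>\<omega> p. Z (e (fst p)) (snd p) \<omega>) \<in> P \<rightarrow>\<^sub>M borel"
      by (rule measurable_coordinatewise_then_product) (rule Zmeas)
    ultimately have "(\<lambda>\<omega>. F (t, N (\<lambda>p. Z (e (fst p)) (snd p) \<omega>))) \<in> borel_measurable P"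
      by (rule measurable_compose[rotated])
    then show ?thesis by (simp add: X_def[abs_def] Y_def)
  qed
  have Ynorm: "norm (Y \<omega>) \<le> (\<Sum>p\<in>UNIV \<times> ?J. \<bar>Z (e (snd p)) (fst p) \<omega>\<bar>)" for \<omega>
  proof -
    have "norm (Y \<omega>) \<le> (\<Sum>i\<in>UNIV. norm (Y \<omega> $ i))"
      unfolding norm_vec_def by (rule L2_set_le_sum) simp
    also have "\<dots> \<le> (\<Sum>i\<in>UNIV. \<Sum>k\<in>?J. \<bar>Z (e k) i \<omega>\<bar>)"
    proof (rule sum_mono)
      fix i
      have "norm (Z (e k) i \<omega> *\<^sub>R e k) = \<bar>Z (e k) i \<omega>\<bar>" if "k \<in> ?J" for k
        using on[OF that that] by (simp add: norm_eq_1[THEN iffD2])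
      then have "(\<Sum>k\<in>?J. norm (Z (e k) i \<omega> *\<^sub>R e k)) = (\<Sum>k\<in>?J. \<bar>Z (e k) i \<omega>\<bar>)"
        by (intro sum.cong) auto
      then show "norm (Y \<omega> $ i) \<le> (\<Sum>k\<in>?J. \<bar>Z (e k) i \<omega>\<bar>)"
        using norm_sum[of "\<lambda>k. Z (e k) i \<omega> *\<^sub>R e k" ?J] by (simp add: Y_def N_def)
    qed
    finally show ?thesis by (simp add: sum.cartesian_product split_beta)
  qed
  have Xint: "integrable P (\<lambda>\<omega>. \<bar>X t \<omega> $ i\<bar> powr 2)" if t: "t \<in> {0..T}" for t i
  proof -
    let ?I = "(UNIV :: 'd set) \<times> ?J"
    \<comment> \<open>The factor 2 comes from squaring and \<open>card ?I\<close> from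
      \<open>exp_sum_le\<close>. The modulus of \<open>A\<close> appears because its sign is left
      open by the growth bound.\<close>
    let ?n = "real (card ?I) * (2 * \<bar>A\<bar>)"
    have "integrable P (\<lambda>\<omega>. exp (?n * \<bar>W i f \<omega>\<bar>))" for i f
      by (rule integrable_exp_centered_gaussian[OF prob_space_P gaussian_W])
    then have "integrable P (\<lambda>\<omega>. exp (?n * \<bar>Z f i \<omega>\<bar>))" for i f
    proof (rule integrable_cong_AE_imp)
      show "(\<lambda>\<omega>. exp (?n * \<bar>Z f i \<omega>\<bar>)) \<in> borel_measurable P" using Zmeas[of f i] by measurable
      show "AE \<omega> in P. exp (?n * \<bar>W i f \<omega>\<bar>) = exp (?n * \<bar>Z f i \<omega>\<bar>)"
        using ZW[of f i] by eventually_elim simp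
    qed
    then have i: "integrable P (\<lambda>\<omega>. C\<^sup>2 * (\<Sum>p\<in>?I. exp (?n * \<bar>Z (e (snd p)) (fst p) \<omega>\<bar>)))"
      by (intro integrable_mult_right Bochner_Integration.integrable_sum)
    have bd: "\<bar>X t \<omega> $ i\<bar> powr 2 \<le> C\<^sup>2 * (\<Sum>p\<in>?I. exp (?n * \<bar>Z (e (snd p)) (fst p) \<omega>\<bar>))" for \<omega>
    proof -
      let ?s = "\<Sum>p\<in>?I. \<bar>Z (e (snd p)) (fst p) \<omega>\<bar>"
      have "A * norm (Y \<omega>) \<le> \<bar>A\<bar> * norm (Y \<omega>)" by (intro mult_right_mono) auto
      also have "\<dots> \<le> \<bar>A\<bar> * ?s" by (intro mult_left_mono Ynorm) auto
      finally have "C * exp (A * norm (Y \<omega>)) \<le> C * exp (\<bar>A\<bar> * ?s)"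
        using C0 by (intro mult_left_mono) auto
      then have "\<bar>X t \<omega> $ i\<bar> \<le> C * exp (\<bar>A\<bar> * ?s)"
        using F(2)[OF t, of "Y \<omega>"] component_le_norm_cart[of "X t \<omega>" i] by (simp add: X_def)
      then have "\<bar>X t \<omega> $ i\<bar>\<^sup>2 \<le> (C * exp (\<bar>A\<bar> * ?s))\<^sup>2"
        by (intro power_mono) auto
      also have "\<dots> = C\<^sup>2 * exp (\<Sum>p\<in>?I. 2 * \<bar>A\<bar> * \<bar>Z (e (snd p)) (fst p) \<omega>\<bar>)"
        by (simp add: power_mult_distrib exp_double[symmetric] mult.assoc flip: sum_distrib_left)
      also have "\<dots> \<le> C\<^sup>2 * (\<Sum>p\<in>?I. exp (real (card ?I) * (2 * \<bar>A\<bar> * \<bar>Z (e (snd p)) (fst p) \<omega>\<bar>)))"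
        using assms(4) by (intro mult_left_mono exp_sum_le) auto
      finally show ?thesis by (simp add: mult.assoc)
    qed
    show ?thesis
    proof (rule Bochner_Integration.integrable_bound[OF i])
      have "(\<lambda>\<omega>. X t \<omega> $ i) \<in> borel_measurable P"
        by (rule measurable_compose[OF Xmeas]) (intro borel_measurable_continuous_onI continuous_intros)
      then show "(\<lambda>\<omega>. \<bar>X t \<omega> $ i\<bar> powr 2) \<in> borel_measurable P" by measurable
      show "AE \<omega> in P. norm (\<bar>X t \<omega> $ i\<bar> powr 2) \<le>
          norm (C\<^sup>2 * (\<Sum>p\<in>?I. exp (?n * \<bar>Z (e (snd p)) (fst p) \<omega>\<bar>)))"
        using bd by (intro AE_I2) (simp add: order_trans[OF _ abs_ge_self])
    qed
  qed
  have Xeq: "AE \<omega> in P. \<forall>t\<in>{0..T}.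
        set_integrable lborel {0..t}
          (\<lambda>s. wick H T \<iota> W i (\<lambda>\<omega>'. b s (X s \<omega>') $ i) (sigma_proj \<iota> e K \<sigma> i s t) \<omega>) \<and>
        X t \<omega> $ i =
          c $ i * stoch_exp W i (sigma_proj \<iota> e K \<sigma> i 0 t) \<omega> +
          (LINT s:{0..t}|lborel.
             wick H T \<iota> W i (\<lambda>\<omega>'. b s (X s \<omega>') $ i) (sigma_proj \<iota> e K \<sigma> i s t) \<omega>)" for i
  proof -
    have "AE \<omega> in P. \<forall>k. Z (e k) i \<omega> = W i (e k) \<omega>" using ZW by (simp add: AE_all_countable)
    \<comment> \<open>Every component \<open>i'\<close> is included: a shift in direction
      \<open>i\<close> has to leave the other entries of \<open>Y\<close> in place.\<close>
    moreover have "AE \<omega> in P. \<forall>k i'. \<forall>j g. is_Phi H T \<iota> g (Phi H T \<iota> g) \<longrightarrow>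
         Z (e k) i' (\<omega> - cm_shift j g) = Z (e k) i' \<omega> - (if i' = j then inner (e k) g else 0)"
      using Zshift unfolding AE_all_countable by blast
    ultimately show ?thesis using AE_space
    proof eventually_elim
      case (elim \<omega>)
      \<comment> \<open>Linearity of \<open>W\<close> along each path enters here: on the span, the
        functional is fixed by its \<open>K\<close> values on the basis, so one null set covers all
        integrands and \<open>Y \<omega> $ i\<close> represents it.\<close>
      have W_eq: "W i f \<omega> = inner (Y \<omega> $ i) f" if "f \<in> ?S" for f
        using that
      proof (induction rule: span_induct_alt)
        case base
        then show ?case using linear_0[OF linear_W[OF elim(3), of i]] by simp
      next
        case (step r x y)
        then obtain k where k: "k \<in> ?J" "x = e k" by auto
        have "inner (Y \<omega> $ i) (e k) = W i (e k) \<omega>"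
          using k elim(1) by (simp add: Y_def N_def inner_sum_left on if_distrib[of "\<lambda>r. _ * r"] sum.delta cong: if_cong)
        then show ?case
          using step(2) linear_add[OF linear_W[OF elim(3), of i], of "r *\<^sub>R x" y]
            linear_scale[OF linear_W[OF elim(3), of i], of r x] k by (simp add: inner_add_right)
      qed
      have exp_eq: "stoch_exp W i f \<omega> = wexp (Y \<omega> $ i) f" if "f \<in> ?S" for f
        by (simp add: stoch_exp_def wexp_def W_eq[OF that])
      \<comment> \<open>Coefficient \<open>k\<close> of entry \<open>i\<close> loses
        \<open>inner (e k) f\<close>; summed up this is the expansion of \<open>f\<close>, as
        \<open>f\<close> lies in the span.\<close>
      have shift: "Y (\<omega> - cm_shift i f) = Y \<omega> - axis i f" if f: "f \<in> ?S" for f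
      proof -
        have "is_Phi H T \<iota> f (Phi H T \<iota> f)"
        proof (rule is_Phi_Phi[OF f])
          fix x assume "x \<in> e ` ?J"
          then obtain k where "k \<in> ?J" "x = e k" by auto
          then show "\<exists>g. is_Phi H T \<iota> x g" using Phi_e[of k] by (intro exI[of _ "\<xi> k"]) simp
        qed
        then have z: "Z (e k) j (\<omega> - cm_shift i f) = Z (e k) j \<omega> - (if j = i then inner (e k) f else 0)" for k j
          using elim(2) by blast
        have f': "(\<Sum>k\<in>?J. inner (e k) f *\<^sub>R e k) = f"
          by (rule orthonormal_expansion[OF on _ f]) auto
        have "(axis i f :: 'h ^ 'd) $ j = (if j = i then f else 0)" for j by (simp add: axis_def)
        then show ?thesis
          by (simp add: vec_eq_iff Y_def N_def z scaleR_diff_left sum_subtractf f'[simplified])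
      qed
      \<comment> \<open>Along this path the Wick product is the deterministic integrand at z =
        \<open>Y \<omega>\<close>, for all s and t simultaneously.\<close>
      have wick_eq: "wick H T \<iota> W i (\<lambda>\<omega>'. b s (X s \<omega>') $ i) (sigma_proj \<iota> e K \<sigma> i s t) \<omega> =
          b s (F (s, Y \<omega> - axis i (\<Gamma> i t - \<Gamma> i s))) $ i * wexp (Y \<omega> $ i) (\<Gamma> i t - \<Gamma> i s)"
        if "s \<in> {0..t}" "t \<in> {0..T}" for s t
      proof -
        have g: "sigma_proj \<iota> e K \<sigma> i s t = \<Gamma> i t - \<Gamma> i s" using that by (intro sigma_proj) auto
        have "\<Gamma> i t - \<Gamma> i s \<in> ?S" by (intro span_diff \<Gamma>_span)
        then show ?thesis by (simp add: wick_def translate_def g exp_eq X_def shift)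
      qed
      show ?case
      proof (intro ballI conjI)
        fix t assume t: "t \<in> {0..T}"
        show "set_integrable lborel {0..t}
            (\<lambda>s. wick H T \<iota> W i (\<lambda>\<omega>'. b s (X s \<omega>') $ i) (sigma_proj \<iota> e K \<sigma> i s t) \<omega>)"
          using F(3)[OF t, of "Y \<omega>" i] wick_eq[OF _ t] by (subst set_integrable_cong[OF refl refl]) auto
        have "sigma_proj \<iota> e K \<sigma> i 0 t = \<Gamma> i t" using t sigma_proj[of 0 t i] by (simp add: \<Gamma>0)
        moreover have "(LINT s:{0..t}|lborel.
             wick H T \<iota> W i (\<lambda>\<omega>'. b s (X s \<omega>') $ i) (sigma_proj \<iota> e K \<sigma> i s t) \<omega>) =
           (LINT s:{0..t}|lborel. b s (F (s, Y \<omega> - axis i (\<Gamma> i t - \<Gamma> i s))) $ i * wexp (Y \<omega> $ i) (\<Gamma> i t - \<Gamma> i s))"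
          by (rule set_lebesgue_integral_cong) (use wick_eq[OF _ t] in auto)
        ultimately show "X t \<omega> $ i =
          c $ i * stoch_exp W i (sigma_proj \<iota> e K \<sigma> i 0 t) \<omega> +
          (LINT s:{0..t}|lborel.
             wick H T \<iota> W i (\<lambda>\<omega>'. b s (X s \<omega>') $ i) (sigma_proj \<iota> e K \<sigma> i s t) \<omega>)"
          using F(4)[OF t, of "Y \<omega>" i] by (simp add: X_def exp_eq[OF \<Gamma>_span])
      qed
    qed
  qed
  have "mild_solution H T P \<iota> W e K b \<sigma> c X"
    unfolding mild_solution_def
  proof (intro conjI ballI allI)
    show "X t \<in> borel_measurable P" for t by (rule Xmeas)
    show "AE \<omega> in P. continuous_on {0..T} (\<lambda>t. X t \<omega>)"
      unfolding X_def by (intro AE_I2 Fcont continuous_intros)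
    show "\<exists>p>1. integrable P (\<lambda>\<omega>. \<bar>X t \<omega> $ i\<bar> powr p)" if "t \<in> {0..T}" for i t
      using Xint[OF that] by (intro exI[of _ 2]) auto
  qed (rule Xeq)
  then show ?thesis by blast
qed

end
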